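(* For each pivotal structure $a$ on a fusion category $\mathcal{C}$ over $\mathbb{C}$ there exists a conjugate pivotal structure $\overline{a}$ on $\mathcal{C}$ such that for every object $c\in\mathcal{C}$ the left dimension of $c$ with respect to $\overline{a}$ is the complex conjugate of the left dimension of $c$ with respect to $a$.
   Context: A fusion category over $\mathbb{C}$ is a semisimple, rigid, monoidal $\mathbb{C}$-linear abelian category with finite-dimensional Hom spaces, tensor product bilinear on morphisms, simple unit $1$ and finitely many isomorphism classes of simple objects; it is treated as strict. The right dual of $c$ is $c^{*}$ with $\mathrm{ev}_c:c^{*}\otimes c\to1$, $\mathrm{coev}_c:1\to c\otimes c^{*}$; the left dual is ${}^{*}c$ with $\mathrm{ev}'_c:c\otimes{}^{*}c\to1$, $\mathrm{coev}'_c:1\to{}^{*}c\otimes c$; canonical isomorphisms $({}^{*}c)^{*}\cong c\cong{}^{*}(c^{*})$ are treated as identities. A pivotal structure is a monoidal natural isomorphism $a:\mathrm{id}_{\mathcal{C}}\to(-)^{**}$. The left dimension of $c$ with respect to $a$ is $\mathrm{ev}_c\circ(a_{{}^{*}c}\otimes\mathrm{id}_c)\circ\mathrm{coev}'_c\in\mathrm{End}(1)=\mathbb{C}$. *)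

theory Defs
  imports Complex_Main
begin

text \<open>
  The elements of \<^typ>\<open>'o\<close> are the objects. Every hom space is a subspace of a single complex
  vector space \<^typ>\<open>'m\<close>, for instance of the direct sum of all hom spaces, which every
  \<open>\<complex>\<close>-linear category admits; composition and tensor product of morphisms are constrained only
  on morphisms of matching types. As the zero vector belongs to every hom space, a morphism does
  not determine its source and target, and a notion that depends on them takes the objects as
  arguments.

  Composition is written in the usual order: \<open>g \<cdot> f\<close> is \<open>g\<close> after \<open>f\<close>.
  The last six components are chosen right and left duals with their (co)evaluations.
\<close>

record ('o, 'm) category_data =
  Hom :: "'o \<Rightarrow> 'o \<Rightarrow> 'm set"
  ident :: "'o \<Rightarrow> 'm"  ("\<iota>\<index>")
  cmp :: "'m \<Rightarrow> 'm \<Rightarrow> 'm"  (infixr "\<cdot>\<index>" 67)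
  smul :: "complex \<Rightarrow> 'm \<Rightarrow> 'm"
  unit_obj :: "'o"  ("\<one>\<index>")
  tensor_obj :: "'o \<Rightarrow> 'o \<Rightarrow> 'o"  (infixr "\<otimes>\<index>" 75)
  tensor :: "'m \<Rightarrow> 'm \<Rightarrow> 'm"  (infixr "\<odot>\<index>" 70)
  rdual :: "'o \<Rightarrow> 'o"
  reval :: "'o \<Rightarrow> 'm"
  rcoeval :: "'o \<Rightarrow> 'm"
  ldual :: "'o \<Rightarrow> 'o"
  leval :: "'o \<Rightarrow> 'm"
  lcoeval :: "'o \<Rightarrow> 'm"

locale linear_category =
  fixes C :: "('o, 'm::ab_group_add) category_data" (structure)
  assumes vector_space_smul: "vector_space (smul C)"
    and subspace_Hom: "module.subspace (smul C) (Hom C x y)"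
    and ident_Hom: "\<iota> x \<in> Hom C x x"
    and comp_Hom: "\<lbrakk>f \<in> Hom C x y; g \<in> Hom C y z\<rbrakk> \<Longrightarrow> g \<cdot> f \<in> Hom C x z"
    and comp_ident: "f \<in> Hom C x y \<Longrightarrow> f \<cdot> \<iota> x = f"
    and ident_comp: "f \<in> Hom C x y \<Longrightarrow> \<iota> y \<cdot> f = f"
    and comp_assoc:
      "\<lbrakk>f \<in> Hom C w x; g \<in> Hom C x y; h \<in> Hom C y z\<rbrakk> \<Longrightarrow> (h \<cdot> g) \<cdot> f = h \<cdot> (g \<cdot> f)"
    and comp_add_left:
      "\<lbrakk>f \<in> Hom C x y; g \<in> Hom C y z; h \<in> Hom C y z\<rbrakk> \<Longrightarrow> (g + h) \<cdot> f = g \<cdot> f + h \<cdot> f"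
    and comp_add_right:
      "\<lbrakk>f \<in> Hom C x y; g \<in> Hom C x y; h \<in> Hom C y z\<rbrakk> \<Longrightarrow> h \<cdot> (f + g) = h \<cdot> f + h \<cdot> g"
    and comp_smul_left:
      "\<lbrakk>f \<in> Hom C x y; g \<in> Hom C y z\<rbrakk> \<Longrightarrow> smul C r g \<cdot> f = smul C r (g \<cdot> f)"
    and comp_smul_right:
      "\<lbrakk>f \<in> Hom C x y; g \<in> Hom C y z\<rbrakk> \<Longrightarrow> g \<cdot> smul C r f = smul C r (g \<cdot> f)"
begin

definition iso :: "'o \<Rightarrow> 'o \<Rightarrow> 'm \<Rightarrow> bool" where
  "iso x y f \<longleftrightarrow> f \<in> Hom C x y \<and> (\<exists>g \<in> Hom C y x. g \<cdot> f = \<iota> x \<and> f \<cdot> g = \<iota> y)"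

definition isomorphic :: "'o \<Rightarrow> 'o \<Rightarrow> bool" where
  "isomorphic x y \<longleftrightarrow> (\<exists>f. iso x y f)"

definition mono :: "'o \<Rightarrow> 'o \<Rightarrow> 'm \<Rightarrow> bool" where
  "mono x y f \<longleftrightarrow> f \<in> Hom C x y \<and>
     (\<forall>w. \<forall>g \<in> Hom C w x. \<forall>h \<in> Hom C w x. f \<cdot> g = f \<cdot> h \<longrightarrow> g = h)"

definition epi :: "'o \<Rightarrow> 'o \<Rightarrow> 'm \<Rightarrow> bool" where
  "epi x y f \<longleftrightarrow> f \<in> Hom C x y \<and>
     (\<forall>w. \<forall>g \<in> Hom C y w. \<forall>h \<in> Hom C y w. g \<cdot> f = h \<cdot> f \<longrightarrow> g = h)"

definition zero_object :: "'o \<Rightarrow> bool" where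
  "zero_object z \<longleftrightarrow> (\<forall>x. Hom C x z = {0} \<and> Hom C z x = {0})"

definition kernel :: "'o \<Rightarrow> 'o \<Rightarrow> 'm \<Rightarrow> 'o \<Rightarrow> 'm \<Rightarrow> bool" where
  "kernel x y f n k \<longleftrightarrow> f \<in> Hom C x y \<and> k \<in> Hom C n x \<and> f \<cdot> k = 0 \<and>
     (\<forall>w. \<forall>g \<in> Hom C w x. f \<cdot> g = 0 \<longrightarrow> (\<exists>!h. h \<in> Hom C w n \<and> k \<cdot> h = g))"

definition cokernel :: "'o \<Rightarrow> 'o \<Rightarrow> 'm \<Rightarrow> 'o \<Rightarrow> 'm \<Rightarrow> bool" where
  "cokernel x y f q p \<longleftrightarrow> f \<in> Hom C x y \<and> p \<in> Hom C y q \<and> p \<cdot> f = 0 \<and>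
     (\<forall>w. \<forall>g \<in> Hom C y w. g \<cdot> f = 0 \<longrightarrow> (\<exists>!h. h \<in> Hom C q w \<and> h \<cdot> p = g))"

text \<open>\<open>x\<close> is the direct sum of \<open>s 0, \<dots>, s (n - 1)\<close>; for \<open>n = 0\<close> this says that \<open>x\<close> is zero.\<close>

definition direct_sum ::
  "'o \<Rightarrow> nat \<Rightarrow> (nat \<Rightarrow> 'o) \<Rightarrow> (nat \<Rightarrow> 'm) \<Rightarrow> (nat \<Rightarrow> 'm) \<Rightarrow> bool" where
  "direct_sum x n s i p \<longleftrightarrow>
     (\<forall>k<n. i k \<in> Hom C (s k) x \<and> p k \<in> Hom C x (s k)) \<and>
     (\<forall>k<n. \<forall>l<n. p k \<cdot> i l = (if k = l then \<iota> (s k) else 0)) \<and>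
     (\<Sum>k<n. i k \<cdot> p k) = \<iota> x"

definition abelian :: bool where
  "abelian \<longleftrightarrow>
     (\<exists>z. zero_object z) \<and>
     (\<forall>x y. \<exists>b i p. direct_sum b 2 (\<lambda>k. if k = 0 then x else y) i p) \<and>
     (\<forall>x y. \<forall>f \<in> Hom C x y. (\<exists>n k. kernel x y f n k) \<and> (\<exists>q p. cokernel x y f q p)) \<and>
     (\<forall>n x k. mono n x k \<longrightarrow> (\<exists>y f. kernel x y f n k)) \<and>
     (\<forall>y q p. epi y q p \<longrightarrow> (\<exists>x f. cokernel x y f q p))"

definition simple :: "'o \<Rightarrow> bool" where
  "simple s \<longleftrightarrow> \<not> zero_object s \<and> (\<forall>w m. mono w s m \<longrightarrow> zero_object w \<or> iso w s m)"

definition semisimple :: bool where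
  "semisimple \<longleftrightarrow> (\<forall>x. \<exists>n s i p. direct_sum x n s i p \<and> (\<forall>k<n. simple (s k)))"

definition finite_dimensional_Homs :: bool where
  "finite_dimensional_Homs \<longleftrightarrow> (\<forall>x y. \<exists>B. finite B \<and> module.span (smul C) B = Hom C x y)"

definition finitely_many_simples :: bool where
  "finitely_many_simples \<longleftrightarrow> (\<exists>S. finite S \<and> (\<forall>s. simple s \<longrightarrow> (\<exists>t \<in> S. isomorphic s t)))"

end

locale strict_monoidal_category = linear_category C
  for C :: "('o, 'm::ab_group_add) category_data" (structure) +
  assumes tensor_obj_assoc: "(x \<otimes> y) \<otimes> z = x \<otimes> (y \<otimes> z)"
    and unit_tensor_obj: "\<one> \<otimes> x = x"
    and tensor_obj_unit: "x \<otimes> \<one> = x"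
    and tensor_Hom:
      "\<lbrakk>f \<in> Hom C x y; g \<in> Hom C z w\<rbrakk> \<Longrightarrow> f \<odot> g \<in> Hom C (x \<otimes> z) (y \<otimes> w)"
    and tensor_ident: "\<iota> x \<odot> \<iota> y = \<iota> (x \<otimes> y)"
    and interchange:
      "\<lbrakk>f \<in> Hom C x y; f' \<in> Hom C y z; g \<in> Hom C u v; g' \<in> Hom C v w\<rbrakk>
        \<Longrightarrow> (f' \<cdot> f) \<odot> (g' \<cdot> g) = (f' \<odot> g') \<cdot> (f \<odot> g)"
    and tensor_assoc:
      "\<lbrakk>f \<in> Hom C x x'; g \<in> Hom C y y'; h \<in> Hom C z z'\<rbrakk> \<Longrightarrow> (f \<odot> g) \<odot> h = f \<odot> (g \<odot> h)"
    and unit_tensor: "f \<in> Hom C x y \<Longrightarrow> \<iota> \<one> \<odot> f = f"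
    and tensor_unit: "f \<in> Hom C x y \<Longrightarrow> f \<odot> \<iota> \<one> = f"
    and tensor_add_left:
      "\<lbrakk>f \<in> Hom C x y; g \<in> Hom C x y; h \<in> Hom C z w\<rbrakk> \<Longrightarrow> (f + g) \<odot> h = f \<odot> h + g \<odot> h"
    and tensor_add_right:
      "\<lbrakk>f \<in> Hom C x y; g \<in> Hom C z w; h \<in> Hom C z w\<rbrakk> \<Longrightarrow> f \<odot> (g + h) = f \<odot> g + f \<odot> h"
    and tensor_smul_left:
      "\<lbrakk>f \<in> Hom C x y; g \<in> Hom C z w\<rbrakk> \<Longrightarrow> smul C r f \<odot> g = smul C r (f \<odot> g)"
    and tensor_smul_right:
      "\<lbrakk>f \<in> Hom C x y; g \<in> Hom C z w\<rbrakk> \<Longrightarrow> f \<odot> smul C r g = smul C r (f \<odot> g)"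
begin

text \<open>
  \<open>x\<close> is a right dual of \<open>c\<close> (equivalently, \<open>c\<close> is a left dual of \<open>x\<close>) with evaluation
  \<open>e : x \<otimes> c \<rightarrow> \<one>\<close> and coevaluation \<open>h : \<one> \<rightarrow> c \<otimes> x\<close>.
\<close>

definition dual_pair :: "'o \<Rightarrow> 'o \<Rightarrow> 'm \<Rightarrow> 'm \<Rightarrow> bool" where
  "dual_pair c x e h \<longleftrightarrow>
     e \<in> Hom C (x \<otimes> c) \<one> \<and> h \<in> Hom C \<one> (c \<otimes> x) \<and>
     (\<iota> c \<odot> e) \<cdot> (h \<odot> \<iota> c) = \<iota> c \<and>
     (e \<odot> \<iota> x) \<cdot> (\<iota> x \<odot> h) = \<iota> x"

end

locale rigid_category = strict_monoidal_category C
  for C :: "('o, 'm::ab_group_add) category_data" (structure) +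
  assumes right_dual: "dual_pair c (rdual C c) (reval C c) (rcoeval C c)"
    and left_dual: "dual_pair (ldual C c) c (leval C c) (lcoeval C c)"
begin

abbreviation rd :: "'o \<Rightarrow> 'o"  ("_\<^sup>\<star>" [999] 999) where
  "c\<^sup>\<star> \<equiv> rdual C c"

abbreviation ld :: "'o \<Rightarrow> 'o"  ("\<^sup>\<star>_" [1000] 1000) where
  "\<^sup>\<star>c \<equiv> ldual C c"

abbreviation ev :: "'o \<Rightarrow> 'm" where
  "ev \<equiv> reval C"

abbreviation coev :: "'o \<Rightarrow> 'm" where
  "coev \<equiv> rcoeval C"

abbreviation ev' :: "'o \<Rightarrow> 'm" where
  "ev' \<equiv> leval C"

abbreviation coev' :: "'o \<Rightarrow> 'm" where
  "coev' \<equiv> lcoeval C"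

text \<open>The right dual \<open>f\<^sup>\<star> : d\<^sup>\<star> \<rightarrow> c\<^sup>\<star>\<close> of a morphism \<open>f : c \<rightarrow> d\<close>.\<close>

definition dual_map :: "'o \<Rightarrow> 'o \<Rightarrow> 'm \<Rightarrow> 'm" where
  "dual_map c d f =
     (ev d \<odot> \<iota> (c\<^sup>\<star>)) \<cdot> (\<iota> (d\<^sup>\<star>) \<odot> f \<odot> \<iota> (c\<^sup>\<star>)) \<cdot> (\<iota> (d\<^sup>\<star>) \<odot> coev c)"

definition double_dual_map :: "'o \<Rightarrow> 'o \<Rightarrow> 'm \<Rightarrow> 'm" where
  "double_dual_map c d f = dual_map (d\<^sup>\<star>) (c\<^sup>\<star>) (dual_map c d f)"

text \<open>
  The mutually inverse canonical isomorphisms between \<open>d\<^sup>\<star> \<otimes> c\<^sup>\<star>\<close> and \<open>(c \<otimes> d)\<^sup>\<star>\<close>, both being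
  right duals of \<open>c \<otimes> d\<close>.
\<close>

definition dual_tensor :: "'o \<Rightarrow> 'o \<Rightarrow> 'm" where
  "dual_tensor c d =
     ((ev d \<cdot> (\<iota> (d\<^sup>\<star>) \<odot> ev c \<odot> \<iota> d)) \<odot> \<iota> ((c \<otimes> d)\<^sup>\<star>)) \<cdot>
     (\<iota> (d\<^sup>\<star>) \<odot> \<iota> (c\<^sup>\<star>) \<odot> coev (c \<otimes> d))"

definition dual_tensor_inv :: "'o \<Rightarrow> 'o \<Rightarrow> 'm" where
  "dual_tensor_inv c d =
     (ev (c \<otimes> d) \<odot> \<iota> (d\<^sup>\<star>) \<odot> \<iota> (c\<^sup>\<star>)) \<cdot>
     (\<iota> ((c \<otimes> d)\<^sup>\<star>) \<odot> ((\<iota> c \<odot> coev d \<odot> \<iota> (c\<^sup>\<star>)) \<cdot> coev c))"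

text \<open>
  The monoidal structure of the double dual functor:
  \<open>c\<^sup>\<star>\<^sup>\<star> \<otimes> d\<^sup>\<star>\<^sup>\<star> \<rightarrow> (d\<^sup>\<star> \<otimes> c\<^sup>\<star>)\<^sup>\<star> \<rightarrow> (c \<otimes> d)\<^sup>\<star>\<^sup>\<star>\<close> and \<open>\<one> \<rightarrow> \<one>\<^sup>\<star> \<rightarrow> \<one>\<^sup>\<star>\<^sup>\<star>\<close>. In the unit constraint,
  \<open>coev \<one> : \<one> \<rightarrow> \<one> \<otimes> \<one>\<^sup>\<star> = \<one>\<^sup>\<star>\<close> and \<open>ev \<one> : \<one>\<^sup>\<star> = \<one>\<^sup>\<star> \<otimes> \<one> \<rightarrow> \<one>\<close> are the canonical isomorphisms.
\<close>

definition double_dual_tensor :: "'o \<Rightarrow> 'o \<Rightarrow> 'm" where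
  "double_dual_tensor c d =
     dual_map ((c \<otimes> d)\<^sup>\<star>) (d\<^sup>\<star> \<otimes> c\<^sup>\<star>) (dual_tensor_inv c d) \<cdot> dual_tensor (d\<^sup>\<star>) (c\<^sup>\<star>)"

definition double_dual_unit :: "'m" where
  "double_dual_unit = dual_map (\<one>\<^sup>\<star>) \<one> (ev \<one>) \<cdot> coev \<one>"

definition pivotal_structure :: "('o \<Rightarrow> 'm) \<Rightarrow> bool" where
  "pivotal_structure a \<longleftrightarrow>
     (\<forall>c. iso c (c\<^sup>\<star>\<^sup>\<star>) (a c)) \<and>
     (\<forall>c d. \<forall>f \<in> Hom C c d. a d \<cdot> f = double_dual_map c d f \<cdot> a c) \<and>
     (\<forall>c d. a (c \<otimes> d) = double_dual_tensor c d \<cdot> (a c \<odot> a d)) \<and>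
     a \<one> = double_dual_unit"

text \<open>
  The canonical isomorphism \<open>c \<rightarrow> (\<^sup>\<star>c)\<^sup>\<star>\<close>, both objects being right duals of \<open>\<^sup>\<star>c\<close>. Its dual
  \<open>(\<^sup>\<star>c)\<^sup>\<star>\<^sup>\<star> \<rightarrow> c\<^sup>\<star>\<close> makes explicit the usual identification in the formula for the left dimension.
\<close>

definition dual_of_ldual :: "'o \<Rightarrow> 'm" where
  "dual_of_ldual c = (ev' c \<odot> \<iota> ((\<^sup>\<star>c)\<^sup>\<star>)) \<cdot> (\<iota> c \<odot> coev (\<^sup>\<star>c))"

definition left_dimension_map :: "('o \<Rightarrow> 'm) \<Rightarrow> 'o \<Rightarrow> 'm" where
  "left_dimension_map a c =
     ev c \<cdot>
     ((dual_map c ((\<^sup>\<star>c)\<^sup>\<star>) (dual_of_ldual c) \<cdot> a (\<^sup>\<star>c)) \<odot> \<iota> c) \<cdot>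
     coev' c"

text \<open>If \<open>\<one>\<close> is simple and hom spaces are finite-dimensional, then \<open>End(\<one>) = \<complex> id\<close> by Schur's lemma.\<close>

definition left_dimension :: "('o \<Rightarrow> 'm) \<Rightarrow> 'o \<Rightarrow> complex" where
  "left_dimension a c = (THE z. left_dimension_map a c = smul C z (\<iota> \<one>))"

end

locale fusion_category = rigid_category C
  for C :: "('o, 'm::ab_group_add) category_data" (structure) +
  assumes abelian: abelian
    and semisimple: semisimple
    and finite_dimensional_Homs: finite_dimensional_Homs
    and simple_unit: "simple \<one>"
    and finitely_many_simples: finitely_many_simples

end

(*
  Write l(c) for the left dimension with respect to a, and r(c) for the left dimension of the right
  dual c' of c. As l is a ring homomorphism on the Grothendieck ring, the vector v = (l(s)) over the
  simple objects s satisfies N_c v = l(c) v for the fusion matrix N_c. The matrix of c' is the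
  transpose of the nonnegative integer matrix N_c, so pairing N_c v with v gives r(c) = cnj (l(c)).

  It remains to make r the left dimension of a pivotal structure. For an endomorphism h of s \<otimes> t,
  closing s on the left and t on the right gives a number that can be compared with both full
  traces. If s and t are simple, the right trace of their endomorphisms is r/l times the left trace,
  hence tr_R(h) = (r(s)/l(s)) (r(t)/l(t)) tr_L(h). So r/l is multiplicative along fusion, i.e. it
  defines a monoidal automorphism of the identity functor, and a composed with the inverse of this
  automorphism has left dimension r.
*)

theory Submission
  imports Defs "HOL-Computational_Algebra.Fundamental_Theorem_Algebra"
begin

text \<open>Conjugation acts on scalars only: a complex linear category carries no antilinear
  symmetry, so conjugating morphisms is not an option. What can be varied is the pivotal structure,
  and two of these differ by a monoidal automorphism \<theta> of the identity functor, that is, by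
  nonzero scalars on the simple objects that are multiplicative along fusion. So conjugation has to
  be found inside the dimensions, as passage to the dual object, and then \<theta> is forced.

  The inverse comes from the shape of the left dimension. Once the right dual of c also serves as
  its left dual, the loop of c contains the inverse of the pivotal isomorphism at c, so composing it
  with \<theta> divides the left dimension of a simple object by its scalar. Hence \<theta> must be
  l/r.

  The definition of left dimension involves chosen left duals and explicit comparison maps between
  double duals. Both are absorbed once and for all into the pair \<open>Et\<close>,
  \<open>Ht\<close>; the trace arguments use only its naturality and its compatibility with tensor
  products and duals.\<close>

section \<open>Typed arrows and duality\<close>

text \<open>
  An arrow carries its source and target. The side conditions of the laws below then contain no
  objects besides those in the equation, so that the simplifier can discharge them.
\<close>

type_synonym ('o, 'm) arrow = "'o \<times> 'm \<times> 'o"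

definition src :: "('o, 'm) arrow \<Rightarrow> 'o" where "src t = fst t"
definition mor :: "('o, 'm) arrow \<Rightarrow> 'm" where "mor t = fst (snd t)"
definition trg :: "('o, 'm) arrow \<Rightarrow> 'o" where "trg t = snd (snd t)"

lemma arrow_sel [simp]: "src (x, f, y) = x" "mor (x, f, y) = f" "trg (x, f, y) = y"
  by (simp_all add: src_def mor_def trg_def)

lemma arrow_eqI: "src t = src u \<Longrightarrow> trg t = trg u \<Longrightarrow> mor t = mor u \<Longrightarrow> t = u"
  by (simp add: src_def mor_def trg_def prod_eq_iff)

context linear_category
begin

definition arr :: "('o, 'm) arrow \<Rightarrow> bool" where
  "arr t \<longleftrightarrow> mor t \<in> Hom C (src t) (trg t)"

definition Id :: "'o \<Rightarrow> ('o, 'm) arrow" where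
  "Id x = (x, \<iota> x, x)"

definition acomp :: "('o, 'm) arrow \<Rightarrow> ('o, 'm) arrow \<Rightarrow> ('o, 'm) arrow"  (infixr "\<bullet>" 60) where
  "t \<bullet> u = (src u, mor t \<cdot> mor u, trg t)"

lemma arr_tuple [simp]: "arr (x, f, y) \<longleftrightarrow> f \<in> Hom C x y"
  by (simp add: arr_def)

lemma mor_Hom: "arr t \<Longrightarrow> src t = x \<Longrightarrow> trg t = y \<Longrightarrow> mor t \<in> Hom C x y"
  by (auto simp: arr_def)

lemma Id_simps [simp]: "src (Id x) = x" "trg (Id x) = x" "mor (Id x) = \<iota> x" "arr (Id x)"
  by (simp_all add: Id_def ident_Hom)

lemma acomp_simps [simp]: "src (t \<bullet> u) = src u" "trg (t \<bullet> u) = trg t" "mor (t \<bullet> u) = mor t \<cdot> mor u"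
  by (simp_all add: acomp_def)

lemma arr_acomp [simp]: "\<lbrakk>arr t; arr u; src t = trg u\<rbrakk> \<Longrightarrow> arr (t \<bullet> u)"
  by (simp add: acomp_def arr_def comp_Hom)

lemma acomp_assoc [simp]:
  "\<lbrakk>arr t; arr u; arr v; src t = trg u; src u = trg v\<rbrakk> \<Longrightarrow> (t \<bullet> u) \<bullet> v = t \<bullet> u \<bullet> v"
  by (rule arrow_eqI) (auto simp: arr_def intro: comp_assoc)

lemma Id_acomp [simp]: "\<lbrakk>arr t; trg t = x\<rbrakk> \<Longrightarrow> Id x \<bullet> t = t"
  by (rule arrow_eqI) (auto simp: arr_def intro: ident_comp)

lemma acomp_Id [simp]: "\<lbrakk>arr t; src t = x\<rbrakk> \<Longrightarrow> t \<bullet> Id x = t"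
  by (rule arrow_eqI) (auto simp: arr_def intro: comp_ident)

text \<open>Composites are kept associated to the right, so the left-hand side of
  \<open>t \<bullet> u = v\<close> does not occur as a subterm of a longer composite. This version
  carries the tail \<open>w\<close> along.\<close>

lemma acomp_extend:
  "\<lbrakk>t \<bullet> u = v; arr t; arr u; arr w; src t = trg u; src u = trg w\<rbrakk> \<Longrightarrow> t \<bullet> u \<bullet> w = v \<bullet> w"
  by (metis acomp_assoc)

end

section \<open>Whiskering and interchange\<close>

context strict_monoidal_category
begin

text \<open>Composites of whiskered arrows serve as a normal form: a tensor product of two arrows
  splits into two whiskerings, the whiskering laws are rewrite rules, and the one structural
  relation left outside the simplifier is \<open>exchange\<close>.\<close>

definition lw :: "'o \<Rightarrow> ('o, 'm) arrow \<Rightarrow> ('o, 'm) arrow" where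
  "lw x t = (x \<otimes> src t, \<iota> x \<odot> mor t, x \<otimes> trg t)"

definition rw :: "('o, 'm) arrow \<Rightarrow> 'o \<Rightarrow> ('o, 'm) arrow" where
  "rw t x = (src t \<otimes> x, mor t \<odot> \<iota> x, trg t \<otimes> x)"

declare tensor_obj_assoc [simp] unit_tensor_obj [simp] tensor_obj_unit [simp]

lemma whisker_simps [simp]:
  "src (lw x t) = x \<otimes> src t" "trg (lw x t) = x \<otimes> trg t" "mor (lw x t) = \<iota> x \<odot> mor t"
  "src (rw t x) = src t \<otimes> x" "trg (rw t x) = trg t \<otimes> x" "mor (rw t x) = mor t \<odot> \<iota> x"
  by (simp_all add: lw_def rw_def)

lemma arr_whisker [simp]: "arr t \<Longrightarrow> arr (lw x t)" "arr t \<Longrightarrow> arr (rw t x)"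
  by (simp_all add: lw_def rw_def tensor_Hom ident_Hom arr_def)

lemma whisker_Id [simp]: "lw x (Id y) = Id (x \<otimes> y)" "rw (Id x) y = Id (x \<otimes> y)"
  by (rule arrow_eqI; simp add: tensor_ident)+

lemma lw_acomp [simp]: "\<lbrakk>arr t; arr u; src t = trg u\<rbrakk> \<Longrightarrow> lw x (t \<bullet> u) = lw x t \<bullet> lw x u"
  using interchange[OF ident_Hom ident_Hom, of "mor u" "src u" "trg u" "mor t" "trg t" x]
  by (intro arrow_eqI) (auto simp: arr_def comp_ident[OF ident_Hom])

lemma rw_acomp [simp]: "\<lbrakk>arr t; arr u; src t = trg u\<rbrakk> \<Longrightarrow> rw (t \<bullet> u) x = rw t x \<bullet> rw u x"
  using interchange[OF _ _ ident_Hom ident_Hom, of "mor u" "src u" "trg u" "mor t" "trg t" x]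
  by (intro arrow_eqI) (auto simp: arr_def comp_ident[OF ident_Hom])

lemma lw_unit [simp]: "arr t \<Longrightarrow> lw \<one> t = t"
  by (rule arrow_eqI) (auto simp: arr_def intro: unit_tensor)

lemma rw_unit [simp]: "arr t \<Longrightarrow> rw t \<one> = t"
  by (rule arrow_eqI) (auto simp: arr_def intro: tensor_unit)

lemma lw_lw [simp]: "arr t \<Longrightarrow> lw x (lw y t) = lw (x \<otimes> y) t"
  using tensor_assoc[OF ident_Hom ident_Hom, of "mor t" "src t" "trg t" x y]
  by (intro arrow_eqI) (auto simp: arr_def tensor_ident)

lemma rw_rw [simp]: "arr t \<Longrightarrow> rw (rw t x) y = rw t (x \<otimes> y)"
  using tensor_assoc[OF _ ident_Hom ident_Hom, of "mor t" "src t" "trg t" x y]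
  by (intro arrow_eqI) (auto simp: arr_def tensor_ident)

lemma rw_lw [simp]: "arr t \<Longrightarrow> rw (lw x t) y = lw x (rw t y)"
  using tensor_assoc[OF ident_Hom _ ident_Hom, of "mor t" "src t" "trg t" x y]
  by (intro arrow_eqI) (auto simp: arr_def)

lemma mor_tensor:
  assumes "arr t" "arr u"
  shows "mor t \<odot> mor u = mor (lw (trg t) u \<bullet> rw t (src u))"
    and "mor t \<odot> mor u = mor (rw t (trg u) \<bullet> lw (src t) u)"
proof -
  have t: "mor t \<in> Hom C (src t) (trg t)" and u: "mor u \<in> Hom C (src u) (trg u)"
    using assms by (auto simp: arr_def)
  show "mor t \<odot> mor u = mor (lw (trg t) u \<bullet> rw t (src u))"
    using interchange[OF t ident_Hom ident_Hom u]
    by (simp only: comp_ident[OF u] ident_comp[OF t] whisker_simps acomp_simps)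
  show "mor t \<odot> mor u = mor (rw t (trg u) \<bullet> lw (src t) u)"
    using interchange[OF ident_Hom t u ident_Hom]
    by (simp only: comp_ident[OF t] ident_comp[OF u] whisker_simps acomp_simps)
qed

text \<open>Both sides are the tensor product of \<open>t\<close> and \<open>u\<close>. Neither
  direction is a sensible rewrite rule, so each use names the instance that slides the two strands
  past each other.\<close>

lemma exchange:
  assumes "arr t" "arr u"
  shows "lw (trg t) u \<bullet> rw t (src u) = rw t (trg u) \<bullet> lw (src t) u"
  by (rule arrow_eqI, simp, simp, rule trans[OF mor_tensor(1)[symmetric] mor_tensor(2)])
     (rule assms)+

section \<open>Dual pairs, transposes and mates\<close>

definition adj :: "'o \<Rightarrow> 'o \<Rightarrow> ('o, 'm) arrow \<Rightarrow> ('o, 'm) arrow \<Rightarrow> bool" where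
  "adj c x e h \<longleftrightarrow> arr e \<and> src e = x \<otimes> c \<and> trg e = \<one> \<and> arr h \<and> src h = \<one> \<and> trg h = c \<otimes> x \<and>
     lw c e \<bullet> rw h c = Id c \<and> rw e x \<bullet> lw x h = Id x"

lemma adjD:
  assumes "adj c x e h"
  shows "arr e" "src e = x \<otimes> c" "trg e = \<one>" "arr h" "src h = \<one>" "trg h = c \<otimes> x"
    "lw c e \<bullet> rw h c = Id c" "rw e x \<bullet> lw x h = Id x"
  using assms by (auto simp: adj_def)

lemma adj_zigzag:
  assumes "adj c x e h"
  shows "lw (w \<otimes> c) (rw e v) \<bullet> lw w (rw h (c \<otimes> v)) = Id (w \<otimes> c \<otimes> v)"
    and "lw w (rw e (x \<otimes> v)) \<bullet> lw (w \<otimes> x) (rw h v) = Id (w \<otimes> x \<otimes> v)"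
proof -
  note [simp] = adjD(1-6)[OF assms]
  have "lw w (rw (lw c e \<bullet> rw h c) v) = Id (w \<otimes> c \<otimes> v)"
    by (subst adjD(7)[OF assms]) simp
  then show "lw (w \<otimes> c) (rw e v) \<bullet> lw w (rw h (c \<otimes> v)) = Id (w \<otimes> c \<otimes> v)" by simp
  have "lw w (rw (rw e x \<bullet> lw x h) v) = Id (w \<otimes> x \<otimes> v)"
    by (subst adjD(8)[OF assms]) simp
  then show "lw w (rw e (x \<otimes> v)) \<bullet> lw (w \<otimes> x) (rw h v) = Id (w \<otimes> x \<otimes> v)" by simp
qed

text \<open>With \<open>transpose_of_eval\<close> this is the bijection between arrows
  \<open>y \<otimes> c -> \<one>\<close> and arrows \<open>y -> x\<close>. After \<open>k\<close>
  and \<open>e\<close>, which live on disjoint strands, are exchanged, a triangle identity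
  remains.\<close>

lemma transpose_eval:
  assumes "adj c x e h" "arr k" "src k = y \<otimes> c" "trg k = \<one>"
  shows "e \<bullet> rw (rw k x \<bullet> lw y h) c = k"
proof -
  note [simp] = adjD(1-6)[OF assms(1)] assms(2-)
  have "e \<bullet> rw k (x \<otimes> c) = k \<bullet> lw (y \<otimes> c) e"
    using exchange[of k e] by simp
  from acomp_extend[OF this, of "lw y (rw h c)"]
  have "e \<bullet> rw k (x \<otimes> c) \<bullet> lw y (rw h c) = k \<bullet> lw (y \<otimes> c) e \<bullet> lw y (rw h c)" by simp
  also have "lw (y \<otimes> c) e \<bullet> lw y (rw h c) = Id (y \<otimes> c)"
    using adj_zigzag(1)[OF assms(1), of y \<one>] by simp
  finally show ?thesis by simp
qed

lemma transpose_of_eval: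
  assumes "adj c x e h" "arr g" "src g = y" "trg g = x"
  shows "rw (e \<bullet> rw g c) x \<bullet> lw y h = g"
proof -
  note [simp] = adjD(1-6)[OF assms(1)] assms(2-)
  have "rw g (c \<otimes> x) \<bullet> lw y h = lw x h \<bullet> g"
    using exchange[of g h] by simp
  then have "rw (e \<bullet> rw g c) x \<bullet> lw y h = rw e x \<bullet> lw x h \<bullet> g" by simp
  also have "\<dots> = Id x \<bullet> g"
    by (rule acomp_extend[OF adjD(8)[OF assms(1)]]) simp_all
  finally show ?thesis by simp
qed

text \<open>Arrows into a dual are determined by their pairing with \<open>e\<close>; identities
  between canonical maps into duals are checked in this way.\<close>

lemma eval_inj:
  assumes "adj c x e h" "arr g" "src g = y" "trg g = x" "arr g'" "src g' = y" "trg g' = x"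
    and "e \<bullet> rw g c = e \<bullet> rw g' c"
  shows "g = g'"
  using transpose_of_eval[OF assms(1-4)] transpose_of_eval[OF assms(1,5-7)] assms(8) by metis

text \<open>One half of the adjunction between tensoring on the left with \<open>x\<close> and with
  \<open>c\<close>; the other half is \<open>adjunct_of_inverse\<close>.\<close>

lemma adjunct_inverse:
  assumes "adj c x e h" "arr f" "src f = x \<otimes> i" "trg f = j"
  shows "rw e j \<bullet> lw x (lw c f \<bullet> rw h i) = f"
proof -
  note [simp] = adjD(1-6)[OF assms(1)] assms(2-)
  have "rw e j \<bullet> lw (x \<otimes> c) f = f \<bullet> rw e (x \<otimes> i)"
    using exchange[of e f] by simp
  from acomp_extend[OF this, of "lw x (rw h i)"]
  have "rw e j \<bullet> lw x (lw c f \<bullet> rw h i) = f \<bullet> rw e (x \<otimes> i) \<bullet> lw x (rw h i)" by simp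
  also have "rw e (x \<otimes> i) \<bullet> lw x (rw h i) = Id (x \<otimes> i)"
    using adj_zigzag(2)[OF assms(1), of \<one> i] by simp
  finally show ?thesis by simp
qed

lemma adjunct_of_inverse:
  assumes "adj c x e h" "arr g" "src g = i" "trg g = c \<otimes> j"
  shows "lw c (rw e j \<bullet> lw x g) \<bullet> rw h i = g"
proof -
  note [simp] = adjD(1-6)[OF assms(1)] assms(2-)
  have "lw (c \<otimes> x) g \<bullet> rw h i = rw h (c \<otimes> j) \<bullet> g"
    using exchange[of h g] by simp
  then have "lw c (rw e j \<bullet> lw x g) \<bullet> rw h i = lw c (rw e j) \<bullet> rw h (c \<otimes> j) \<bullet> g" by simp
  also have "\<dots> = Id (c \<otimes> j) \<bullet> g"
    by (rule acomp_extend) (use adj_zigzag(1)[OF assms(1), of \<one> j] in simp_all)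
  finally show ?thesis by simp
qed

text \<open>Mates for the evaluations are mates for the coevaluations. Naturality and monoidality
  therefore need to be verified for evaluations only and are transported to coevaluations from
  here.\<close>

lemma mate_coeval:
  assumes "adj c x e h" "adj d y e' h'"
    and "arr f" "src f = c" "trg f = d" "arr g" "src g = y" "trg g = x"
    and eq: "e \<bullet> rw g c = e' \<bullet> lw y f"
  shows "rw f x \<bullet> h = lw d g \<bullet> h'"
proof -
  note [simp] = adjD(1-6)[OF assms(1)] adjD(1-6)[OF assms(2)] assms(3-8)
  have 1: "rw h' (d \<otimes> x) \<bullet> rw f x \<bullet> h = lw (d \<otimes> y) (rw f x) \<bullet> rw h' (c \<otimes> x) \<bullet> h"
    by (subst acomp_extend[OF exchange[of h' "rw f x", symmetric, simplified]]) simp_all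
  have 2: "rw h' (c \<otimes> x) \<bullet> h = lw (d \<otimes> y) h \<bullet> h'"
    using exchange[of h' h] by simp
  have 3: "lw d (rw g (c \<otimes> x)) \<bullet> lw (d \<otimes> y) h = lw (d \<otimes> x) h \<bullet> lw d g"
    using arg_cong[OF exchange[of g h], of "lw d"] by simp
  \<comment> \<open>A triangle identity for \<open>d\<close> is inserted and \<open>h'\<close> is
    made to act first. This brings \<open>e'\<close> and \<open>f\<close> together, so that
    \<open>eq\<close> trades them for \<open>e\<close> and \<open>g\<close>; a triangle identity for
    \<open>c\<close> then removes \<open>e\<close> and \<open>h\<close>.\<close>
  have "rw f x \<bullet> h = (lw d (rw e' x) \<bullet> rw h' (d \<otimes> x)) \<bullet> rw f x \<bullet> h"
    using adj_zigzag(1)[OF assms(2), of \<one> x] by simp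
  also have "\<dots> = lw d (rw (e' \<bullet> lw y f) x) \<bullet> lw (d \<otimes> y) h \<bullet> h'"
    by (simp add: 1 2)
  also have "\<dots> = lw d (rw e x) \<bullet> lw d (rw g (c \<otimes> x)) \<bullet> lw (d \<otimes> y) h \<bullet> h'"
    by (simp flip: eq)
  also have "\<dots> = lw d (rw e x) \<bullet> lw (d \<otimes> x) h \<bullet> lw d g \<bullet> h'"
    using acomp_extend[OF 3, of h'] by simp
  also have "\<dots> = lw d g \<bullet> h'"
    using acomp_extend[OF adj_zigzag(2)[OF assms(1), of d \<one>], of "lw d g \<bullet> h'"] by simp
  finally show ?thesis .
qed

text \<open>The pairs are nested. In each triangle identity the inner evaluation \<open>e\<close>
  slides past the inner coevaluation \<open>h'\<close>, which leaves the triangle identities of the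
  two factors.\<close>

lemma adj_tensor:
  assumes "adj c x e h" "adj d y e' h'"
  shows "adj (c \<otimes> d) (y \<otimes> x) (e' \<bullet> lw y (rw e d)) (lw c (rw h' x) \<bullet> h)"
proof -
  note [simp] = adjD(1-6)[OF assms(1)] adjD(1-6)[OF assms(2)]
  have 1: "lw (c \<otimes> d \<otimes> y) (rw e d) \<bullet> lw c (rw h' (x \<otimes> c \<otimes> d)) = lw c (rw h' d) \<bullet> lw c (rw e d)"
    using arg_cong[OF exchange[of h' "rw e d"], of "lw c"] by simp
  have "lw (c \<otimes> d) e' \<bullet> lw (c \<otimes> d \<otimes> y) (rw e d) \<bullet> lw c (rw h' (x \<otimes> c \<otimes> d)) \<bullet> rw h (c \<otimes> d)
     = lw (c \<otimes> d) e' \<bullet> lw c (rw h' d) \<bullet> lw c (rw e d) \<bullet> rw h (c \<otimes> d)"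
    using acomp_extend[OF 1, of "rw h (c \<otimes> d)"] by simp
  also have "\<dots> = Id (c \<otimes> d)"
    using adj_zigzag(1)[OF assms(1), of \<one> d] adj_zigzag(1)[OF assms(2), of c \<one>] by simp
  finally have A: "lw (c \<otimes> d) e' \<bullet> lw (c \<otimes> d \<otimes> y) (rw e d) \<bullet> lw c (rw h' (x \<otimes> c \<otimes> d)) \<bullet> rw h (c \<otimes> d)
     = Id (c \<otimes> d)" .
  have 2: "lw y (rw e (d \<otimes> y \<otimes> x)) \<bullet> lw (y \<otimes> x \<otimes> c) (rw h' x) = lw y (rw h' x) \<bullet> lw y (rw e x)"
    using arg_cong[OF exchange[of e "rw h' x"], of "lw y"] by simp
  have "rw e' (y \<otimes> x) \<bullet> lw y (rw e (d \<otimes> y \<otimes> x)) \<bullet> lw (y \<otimes> x \<otimes> c) (rw h' x) \<bullet> lw (y \<otimes> x) h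
     = rw e' (y \<otimes> x) \<bullet> lw y (rw h' x) \<bullet> lw y (rw e x) \<bullet> lw (y \<otimes> x) h"
    using acomp_extend[OF 2, of "lw (y \<otimes> x) h"] by simp
  also have "\<dots> = Id (y \<otimes> x)"
    using adj_zigzag(2)[OF assms(1), of y \<one>] adj_zigzag(2)[OF assms(2), of \<one> x] by simp
  finally have B: "rw e' (y \<otimes> x) \<bullet> lw y (rw e (d \<otimes> y \<otimes> x)) \<bullet> lw (y \<otimes> x \<otimes> c) (rw h' x) \<bullet> lw (y \<otimes> x) h
     = Id (y \<otimes> x)" .
  show ?thesis unfolding adj_def using A B by simp
qed

end

context strict_monoidal_category
begin

lemma dual_pair_adj: "dual_pair c x e h \<Longrightarrow> adj c x (x \<otimes> c, e, \<one>) (\<one>, h, c \<otimes> x)"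
  unfolding dual_pair_def adj_def by (auto intro!: arrow_eqI)

text \<open>Each factor is a transpose and carries one evaluation to the other, so the composite
  preserves \<open>e\<close>, and \<open>eval_inj\<close> identifies it.\<close>

lemma adj_comparison_inverse:
  assumes "adj c x e h" "adj c x' e' h'"
  shows "(rw e' x \<bullet> lw x' h) \<bullet> (rw e x' \<bullet> lw x h') = Id x"
proof (rule eval_inj[OF assms(1)])
  note [simp] = adjD(1-6)[OF assms(1)] adjD(1-6)[OF assms(2)]
  let ?u = "rw e' x \<bullet> lw x' h" and ?v = "rw e x' \<bullet> lw x h'"
  have u: "e \<bullet> rw ?u c = e'" and v: "e' \<bullet> rw ?v c = e"
    by (rule transpose_eval[OF assms(1)] transpose_eval[OF assms(2)]; simp)+
  have "e \<bullet> rw (?u \<bullet> ?v) c = (e \<bullet> rw ?u c) \<bullet> rw ?v c"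
    by simp
  then show "e \<bullet> rw (?u \<bullet> ?v) c = e \<bullet> rw (Id x) c"
    unfolding u v by simp
qed (use adjD[OF assms(1)] adjD[OF assms(2)] in simp_all)

end

section \<open>Dual morphisms and duals of tensor products\<close>

context rigid_category
begin

definition Ev :: "'o \<Rightarrow> ('o, 'm) arrow" where "Ev c = (c\<^sup>\<star> \<otimes> c, ev c, \<one>)"
definition Co :: "'o \<Rightarrow> ('o, 'm) arrow" where "Co c = (\<one>, coev c, c \<otimes> c\<^sup>\<star>)"

lemma adj_Ev_Co: "adj c (c\<^sup>\<star>) (Ev c) (Co c)"
  unfolding Ev_def Co_def by (rule dual_pair_adj[OF right_dual])

lemmas Ev_Co_simps [simp] = adjD(1-6)[OF adj_Ev_Co]

lemma mor_Ev [simp]: "mor (Ev c) = ev c" and mor_Co [simp]: "mor (Co c) = coev c"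
  by (simp_all add: Ev_def Co_def)

definition dual_arr :: "('o, 'm) arrow \<Rightarrow> ('o, 'm) arrow" where
  "dual_arr f = rw (Ev (trg f) \<bullet> lw ((trg f)\<^sup>\<star>) f) ((src f)\<^sup>\<star>) \<bullet> lw ((trg f)\<^sup>\<star>) (Co (src f))"

lemma dual_arr_simps [simp]:
  "src (dual_arr f) = (trg f)\<^sup>\<star>" "trg (dual_arr f) = (src f)\<^sup>\<star>" "arr f \<Longrightarrow> arr (dual_arr f)"
  by (simp_all add: dual_arr_def)

lemma mor_dual_arr:
  assumes "arr f"
  shows "mor (dual_arr f) = dual_map (src f) (trg f) (mor f)"
proof -
  have "dual_arr f = rw (Ev (trg f)) ((src f)\<^sup>\<star>) \<bullet> lw ((trg f)\<^sup>\<star>) (rw f ((src f)\<^sup>\<star>))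
      \<bullet> lw ((trg f)\<^sup>\<star>) (Co (src f))"
    using assms by (simp add: dual_arr_def)
  then show ?thesis by (simp add: dual_map_def)
qed

text \<open>By \<open>eval_inj\<close> this property characterises the dual morphism. From here on
  it replaces the defining formula.\<close>

lemma dual_arr_eval:
  assumes "arr f" "src f = c" "trg f = d"
  shows "Ev c \<bullet> rw (dual_arr f) c = Ev d \<bullet> lw (d\<^sup>\<star>) f"
  unfolding dual_arr_def assms(2,3)
  by (rule transpose_eval[OF adj_Ev_Co]) (simp_all add: assms)

lemma dual_arr_coeval:
  assumes "arr f" "src f = c" "trg f = d"
  shows "rw f (c\<^sup>\<star>) \<bullet> Co c = lw d (dual_arr f) \<bullet> Co d"
  using assms by (intro mate_coeval[OF adj_Ev_Co adj_Ev_Co] dual_arr_eval) simp_all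

abbreviation Ev2 :: "'o \<Rightarrow> 'o \<Rightarrow> ('o, 'm) arrow" where
  "Ev2 c d \<equiv> Ev d \<bullet> lw (d\<^sup>\<star>) (rw (Ev c) d)"

abbreviation Co2 :: "'o \<Rightarrow> 'o \<Rightarrow> ('o, 'm) arrow" where
  "Co2 c d \<equiv> lw c (rw (Co d) (c\<^sup>\<star>)) \<bullet> Co c"

lemma adj_Ev2_Co2: "adj (c \<otimes> d) (d\<^sup>\<star> \<otimes> c\<^sup>\<star>) (Ev2 c d) (Co2 c d)"
  by (rule adj_tensor[OF adj_Ev_Co adj_Ev_Co])

definition Dt :: "'o \<Rightarrow> 'o \<Rightarrow> ('o, 'm) arrow" where
  "Dt c d = rw (Ev2 c d) ((c \<otimes> d)\<^sup>\<star>) \<bullet> lw (d\<^sup>\<star> \<otimes> c\<^sup>\<star>) (Co (c \<otimes> d))"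

definition Dti :: "'o \<Rightarrow> 'o \<Rightarrow> ('o, 'm) arrow" where
  "Dti c d = rw (Ev (c \<otimes> d)) (d\<^sup>\<star> \<otimes> c\<^sup>\<star>) \<bullet> lw ((c \<otimes> d)\<^sup>\<star>) (Co2 c d)"

lemma Dt_simps [simp]:
  "arr (Dt c d)" "src (Dt c d) = d\<^sup>\<star> \<otimes> c\<^sup>\<star>" "trg (Dt c d) = (c \<otimes> d)\<^sup>\<star>"
  "arr (Dti c d)" "src (Dti c d) = (c \<otimes> d)\<^sup>\<star>" "trg (Dti c d) = d\<^sup>\<star> \<otimes> c\<^sup>\<star>"
  by (simp_all add: Dt_def Dti_def)

lemma mor_Dt: "mor (Dt c d) = dual_tensor c d"
proof -
  have "mor (lw (d\<^sup>\<star> \<otimes> c\<^sup>\<star>) (Co (c \<otimes> d))) = mor (lw (d\<^sup>\<star>) (lw (c\<^sup>\<star>) (Co (c \<otimes> d))))"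
    by (simp only: lw_lw Ev_Co_simps)
  then show ?thesis
    unfolding Dt_def dual_tensor_def acomp_simps whisker_simps mor_Ev mor_Co by simp
qed

lemma mor_Dti: "mor (Dti c d) = dual_tensor_inv c d"
proof -
  have "mor (rw (Ev (c \<otimes> d)) (d\<^sup>\<star> \<otimes> c\<^sup>\<star>)) = ev (c \<otimes> d) \<odot> \<iota> (d\<^sup>\<star>) \<odot> \<iota> (c\<^sup>\<star>)"
    by (simp add: tensor_ident)
  then show ?thesis
    unfolding Dti_def dual_tensor_inv_def acomp_simps whisker_simps mor_Ev mor_Co by simp
qed

lemma Dt_eval: "Ev (c \<otimes> d) \<bullet> rw (Dt c d) (c \<otimes> d) = Ev2 c d"
  unfolding Dt_def by (rule transpose_eval[OF adj_Ev_Co]) simp_all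

lemma Dt_coeval: "Co (c \<otimes> d) = lw (c \<otimes> d) (Dt c d) \<bullet> Co2 c d"
  using mate_coeval[OF adj_Ev_Co adj_Ev2_Co2, where f = "Id (c \<otimes> d)" and g = "Dt c d"] Dt_eval by simp

lemma Dti_Dt: "Dti c d \<bullet> Dt c d = Id (d\<^sup>\<star> \<otimes> c\<^sup>\<star>)"
  using adj_comparison_inverse[OF adj_Ev2_Co2 adj_Ev_Co] by (simp only: Dt_def Dti_def)

lemma Ev_unit_Co_unit: "Ev \<one> \<bullet> Co \<one> = Id \<one>"
  using adjD(7)[OF adj_Ev_Co, of \<one>] by simp

end

section \<open>Traces in a pivotal category\<close>

locale pivotal_category = rigid_category C
  for C :: "('o, 'm::ab_group_add) category_data" (structure) +
  fixes a :: "'o \<Rightarrow> 'm"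
  assumes pivotal: "pivotal_structure a"
begin

definition Piv :: "'o \<Rightarrow> ('o, 'm) arrow" where "Piv c = (c, a c, c\<^sup>\<star>\<^sup>\<star>)"

definition Pinv :: "'o \<Rightarrow> ('o, 'm) arrow" where
  "Pinv c = (c\<^sup>\<star>\<^sup>\<star>, SOME g. g \<in> Hom C (c\<^sup>\<star>\<^sup>\<star>) c \<and> g \<cdot> a c = \<iota> c \<and> a c \<cdot> g = \<iota> (c\<^sup>\<star>\<^sup>\<star>), c)"

lemma iso_a: "iso c (c\<^sup>\<star>\<^sup>\<star>) (a c)"
  using pivotal by (auto simp: pivotal_structure_def)

lemma Piv_simps [simp]: "arr (Piv c)" "src (Piv c) = c" "trg (Piv c) = c\<^sup>\<star>\<^sup>\<star>" "mor (Piv c) = a c"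
  using iso_a[of c] by (simp_all add: Piv_def iso_def)

lemma Pinv:
  shows Pinv_simps [simp]: "arr (Pinv c)" "src (Pinv c) = c\<^sup>\<star>\<^sup>\<star>" "trg (Pinv c) = c"
    and Pinv_Piv: "Pinv c \<bullet> Piv c = Id c"
    and Piv_Pinv: "Piv c \<bullet> Pinv c = Id (c\<^sup>\<star>\<^sup>\<star>)"
proof -
  have "mor (Pinv c) \<in> Hom C (c\<^sup>\<star>\<^sup>\<star>) c \<and> mor (Pinv c) \<cdot> a c = \<iota> c \<and> a c \<cdot> mor (Pinv c) = \<iota> (c\<^sup>\<star>\<^sup>\<star>)"
    unfolding Pinv_def arrow_sel by (rule someI_ex) (use iso_a[of c] in \<open>auto simp: iso_def\<close>)
  then show "arr (Pinv c)" "src (Pinv c) = c\<^sup>\<star>\<^sup>\<star>" "trg (Pinv c) = c"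
    "Pinv c \<bullet> Piv c = Id c" "Piv c \<bullet> Pinv c = Id (c\<^sup>\<star>\<^sup>\<star>)"
    by (auto simp: arr_def Pinv_def intro!: arrow_eqI)
qed

lemma Piv_natural:
  assumes "arr f" "src f = c" "trg f = d"
  shows "Piv d \<bullet> f = dual_arr (dual_arr f) \<bullet> Piv c"
proof -
  have "a d \<cdot> mor f = double_dual_map c d (mor f) \<cdot> a c"
    using pivotal assms by (auto simp: pivotal_structure_def arr_def)
  then show ?thesis
    using assms by (auto intro!: arrow_eqI simp: mor_dual_arr double_dual_map_def)
qed

lemma Piv_tensor:
  "Piv (c \<otimes> d) = dual_arr (Dti c d) \<bullet> Dt (d\<^sup>\<star>) (c\<^sup>\<star>) \<bullet> lw (c\<^sup>\<star>\<^sup>\<star>) (Piv d) \<bullet> rw (Piv c) d"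
proof -
  have "a (c \<otimes> d) = double_dual_tensor c d \<cdot> (a c \<odot> a d)"
    using pivotal by (auto simp: pivotal_structure_def)
  also have "\<dots> = mor ((dual_arr (Dti c d) \<bullet> Dt (d\<^sup>\<star>) (c\<^sup>\<star>)) \<bullet> lw (c\<^sup>\<star>\<^sup>\<star>) (Piv d) \<bullet> rw (Piv c) d)"
    using mor_tensor(1)[of "Piv c" "Piv d"]
    by (simp del: acomp_assoc add: mor_dual_arr mor_Dt mor_Dti double_dual_tensor_def)
  finally show ?thesis
    by (intro arrow_eqI) simp_all
qed

lemma Piv_unit: "Piv \<one> = dual_arr (Ev \<one>) \<bullet> Co \<one>"
  using pivotal
  by (intro arrow_eqI) (simp_all add: pivotal_structure_def double_dual_unit_def mor_dual_arr)

section \<open>Left duality from the pivotal structure\<close>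

text \<open>These make \<open>c\<^sup>\<star>\<close> also a left dual of \<open>c\<close>.\<close>

definition Et :: "'o \<Rightarrow> ('o, 'm) arrow" where "Et c = Ev (c\<^sup>\<star>) \<bullet> rw (Piv c) (c\<^sup>\<star>)"
definition Ht :: "'o \<Rightarrow> ('o, 'm) arrow" where "Ht c = lw (c\<^sup>\<star>) (Pinv c) \<bullet> Co (c\<^sup>\<star>)"

text \<open>Both triangle identities are transported along the pivotal isomorphism. In the first,
  \<open>Piv\<close> and \<open>Pinv\<close> meet directly; in the second they slide to the two ends
  of the composite and cancel there.\<close>

lemma adj_Et_Ht: "adj (c\<^sup>\<star>) c (Et c) (Ht c)"
proof -
  have 1: "lw (c\<^sup>\<star>) (rw (Piv c) (c\<^sup>\<star>)) \<bullet> lw (c\<^sup>\<star>) (rw (Pinv c) (c\<^sup>\<star>)) = Id (c\<^sup>\<star> \<otimes> c\<^sup>\<star>\<^sup>\<star> \<otimes> c\<^sup>\<star>)"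
    using arg_cong[OF Piv_Pinv, of "\<lambda>t. lw (c\<^sup>\<star>) (rw t (c\<^sup>\<star>))"] by simp
  have A: "lw (c\<^sup>\<star>) (Et c) \<bullet> rw (Ht c) (c\<^sup>\<star>) = Id (c\<^sup>\<star>)"
    using acomp_extend[OF 1, where w = "rw (Co (c\<^sup>\<star>)) (c\<^sup>\<star>)"] adjD(7)[OF adj_Ev_Co, of "c\<^sup>\<star>"]
    by (simp add: Et_def Ht_def)
  have 2: "rw (Piv c) (c\<^sup>\<star> \<otimes> c) \<bullet> lw (c \<otimes> c\<^sup>\<star>) (Pinv c) = lw (c\<^sup>\<star>\<^sup>\<star> \<otimes> c\<^sup>\<star>) (Pinv c) \<bullet> rw (Piv c) (c\<^sup>\<star> \<otimes> c\<^sup>\<star>\<^sup>\<star>)"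
    using exchange[of "Piv c" "lw (c\<^sup>\<star>) (Pinv c)"] by simp
  have 3: "rw (Ev (c\<^sup>\<star>)) c \<bullet> lw (c\<^sup>\<star>\<^sup>\<star> \<otimes> c\<^sup>\<star>) (Pinv c) = Pinv c \<bullet> rw (Ev (c\<^sup>\<star>)) (c\<^sup>\<star>\<^sup>\<star>)"
    using exchange[of "Ev (c\<^sup>\<star>)" "Pinv c"] by simp
  have 4: "rw (Piv c) (c\<^sup>\<star> \<otimes> c\<^sup>\<star>\<^sup>\<star>) \<bullet> lw c (Co (c\<^sup>\<star>)) = lw (c\<^sup>\<star>\<^sup>\<star>) (Co (c\<^sup>\<star>)) \<bullet> Piv c"
    using exchange[of "Piv c" "Co (c\<^sup>\<star>)"] by simp
  have "rw (Et c) c \<bullet> lw c (Ht c)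
      = rw (Ev (c\<^sup>\<star>)) c \<bullet> rw (Piv c) (c\<^sup>\<star> \<otimes> c) \<bullet> lw (c \<otimes> c\<^sup>\<star>) (Pinv c) \<bullet> lw c (Co (c\<^sup>\<star>))"
    by (simp add: Et_def Ht_def)
  also have "\<dots> = rw (Ev (c\<^sup>\<star>)) c \<bullet> lw (c\<^sup>\<star>\<^sup>\<star> \<otimes> c\<^sup>\<star>) (Pinv c) \<bullet> rw (Piv c) (c\<^sup>\<star> \<otimes> c\<^sup>\<star>\<^sup>\<star>) \<bullet> lw c (Co (c\<^sup>\<star>))"
    using acomp_extend[OF 2, where w = "lw c (Co (c\<^sup>\<star>))"] by simp
  also have "\<dots> = Pinv c \<bullet> rw (Ev (c\<^sup>\<star>)) (c\<^sup>\<star>\<^sup>\<star>) \<bullet> lw (c\<^sup>\<star>\<^sup>\<star>) (Co (c\<^sup>\<star>)) \<bullet> Piv c"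
    unfolding 4 by (subst acomp_extend[OF 3]) simp_all
  also have "\<dots> = Id c"
    using acomp_extend[OF adjD(8)[OF adj_Ev_Co], where w = "Piv c"] by (simp add: Pinv_Piv)
  finally show ?thesis
    using A unfolding adj_def by (simp add: Et_def Ht_def)
qed

lemmas Et_Ht_simps [simp] = adjD(1-6)[OF adj_Et_Ht]

text \<open>This is where naturality of \<open>a\<close> enters: it replaces \<open>f\<close> by its
  double dual, which crosses the evaluation as a single dual.\<close>

lemma Et_natural:
  assumes "arr f" "src f = c" "trg f = d"
  shows "Et d \<bullet> rw f (d\<^sup>\<star>) = Et c \<bullet> lw c (dual_arr f)"
proof -
  note [simp] = assms
  have "Et d \<bullet> rw f (d\<^sup>\<star>) = Ev (d\<^sup>\<star>) \<bullet> rw (Piv d \<bullet> f) (d\<^sup>\<star>)"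
    by (simp add: Et_def)
  also have "\<dots> = Ev (d\<^sup>\<star>) \<bullet> rw (dual_arr (dual_arr f)) (d\<^sup>\<star>) \<bullet> rw (Piv c) (d\<^sup>\<star>)"
    by (subst Piv_natural[OF assms]) simp
  also have "\<dots> = Ev (c\<^sup>\<star>) \<bullet> lw (c\<^sup>\<star>\<^sup>\<star>) (dual_arr f) \<bullet> rw (Piv c) (d\<^sup>\<star>)"
    using acomp_extend[OF dual_arr_eval[of "dual_arr f"], where w = "rw (Piv c) (d\<^sup>\<star>)"] by simp
  also have "lw (c\<^sup>\<star>\<^sup>\<star>) (dual_arr f) \<bullet> rw (Piv c) (d\<^sup>\<star>) = rw (Piv c) (c\<^sup>\<star>) \<bullet> lw c (dual_arr f)"
    using exchange[of "Piv c" "dual_arr f"] by simp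
  finally show ?thesis by (simp add: Et_def)
qed

lemma Ht_natural:
  assumes "arr f" "src f = c" "trg f = d"
  shows "rw (dual_arr f) d \<bullet> Ht d = lw (c\<^sup>\<star>) f \<bullet> Ht c"
  using assms by (intro mate_coeval[OF adj_Et_Ht adj_Et_Ht] Et_natural) simp_all

abbreviation Et2 :: "'o \<Rightarrow> 'o \<Rightarrow> ('o, 'm) arrow" where
  "Et2 c d \<equiv> Et c \<bullet> lw c (rw (Et d) (c\<^sup>\<star>))"

abbreviation Ht2 :: "'o \<Rightarrow> 'o \<Rightarrow> ('o, 'm) arrow" where
  "Ht2 c d \<equiv> lw (d\<^sup>\<star>) (rw (Ht c) d) \<bullet> Ht d"

lemma adj_Et2_Ht2: "adj (d\<^sup>\<star> \<otimes> c\<^sup>\<star>) (c \<otimes> d) (Et2 c d) (Ht2 c d)"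
  by (rule adj_tensor[OF adj_Et_Ht adj_Et_Ht])

text \<open>This is where monoidality of \<open>a\<close> enters. The dual of \<open>Dti\<close>
  contained in \<open>Piv (c \<otimes> d)\<close> crosses the evaluation as \<open>Dti\<close> and
  cancels against \<open>Dt\<close>; the comparison map that remains turns the evaluation of a
  tensor product into the nested one.\<close>

lemma Et_tensor: "Et (c \<otimes> d) \<bullet> lw (c \<otimes> d) (Dt c d) = Et2 c d"
proof -
  let ?A = "lw (c\<^sup>\<star>\<^sup>\<star>) (Piv d) \<bullet> rw (Piv c) d"
  have 1: "lw ((d\<^sup>\<star> \<otimes> c\<^sup>\<star>)\<^sup>\<star>) (Dti c d) \<bullet> rw (Dt (d\<^sup>\<star>) (c\<^sup>\<star>) \<bullet> ?A) ((c \<otimes> d)\<^sup>\<star>)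
      = rw (Dt (d\<^sup>\<star>) (c\<^sup>\<star>) \<bullet> ?A) (d\<^sup>\<star> \<otimes> c\<^sup>\<star>) \<bullet> lw (c \<otimes> d) (Dti c d)"
    using exchange[of "Dt (d\<^sup>\<star>) (c\<^sup>\<star>) \<bullet> ?A" "Dti c d"] by simp
  have 2: "lw (c \<otimes> d) (Dti c d) \<bullet> lw (c \<otimes> d) (Dt c d) = Id (c \<otimes> d \<otimes> d\<^sup>\<star> \<otimes> c\<^sup>\<star>)"
    using arg_cong[OF Dti_Dt[of c d], of "lw (c \<otimes> d)"] by simp
  have 3: "lw (c\<^sup>\<star>\<^sup>\<star>) (rw (Et d) (c\<^sup>\<star>)) \<bullet> rw (Piv c) (d \<otimes> d\<^sup>\<star> \<otimes> c\<^sup>\<star>)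
      = rw (Piv c) (c\<^sup>\<star>) \<bullet> lw c (rw (Et d) (c\<^sup>\<star>))"
    using exchange[of "Piv c" "rw (Et d) (c\<^sup>\<star>)"] by simp
  have "Et (c \<otimes> d) \<bullet> lw (c \<otimes> d) (Dt c d)
      = (Ev ((c \<otimes> d)\<^sup>\<star>) \<bullet> rw (dual_arr (Dti c d)) ((c \<otimes> d)\<^sup>\<star>))
        \<bullet> rw (Dt (d\<^sup>\<star>) (c\<^sup>\<star>) \<bullet> ?A) ((c \<otimes> d)\<^sup>\<star>) \<bullet> lw (c \<otimes> d) (Dt c d)"
    unfolding Et_def Piv_tensor by simp
  also have "\<dots> = Ev (d\<^sup>\<star> \<otimes> c\<^sup>\<star>) \<bullet> (lw ((d\<^sup>\<star> \<otimes> c\<^sup>\<star>)\<^sup>\<star>) (Dti c d)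
        \<bullet> rw (Dt (d\<^sup>\<star>) (c\<^sup>\<star>) \<bullet> ?A) ((c \<otimes> d)\<^sup>\<star>)) \<bullet> lw (c \<otimes> d) (Dt c d)"
    by (subst dual_arr_eval[of _ _ "d\<^sup>\<star> \<otimes> c\<^sup>\<star>"]) simp_all
  also have "\<dots> = (Ev (d\<^sup>\<star> \<otimes> c\<^sup>\<star>) \<bullet> rw (Dt (d\<^sup>\<star>) (c\<^sup>\<star>)) (d\<^sup>\<star> \<otimes> c\<^sup>\<star>)) \<bullet> rw ?A (d\<^sup>\<star> \<otimes> c\<^sup>\<star>)
        \<bullet> lw (c \<otimes> d) (Dti c d) \<bullet> lw (c \<otimes> d) (Dt c d)"
    unfolding 1 by simp
  also have "\<dots> = Ev2 (d\<^sup>\<star>) (c\<^sup>\<star>) \<bullet> rw ?A (d\<^sup>\<star> \<otimes> c\<^sup>\<star>)"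
    unfolding 2 by (subst Dt_eval) simp
  also have "\<dots> = Ev (c\<^sup>\<star>) \<bullet> lw (c\<^sup>\<star>\<^sup>\<star>) (rw (Et d) (c\<^sup>\<star>)) \<bullet> rw (Piv c) (d \<otimes> d\<^sup>\<star> \<otimes> c\<^sup>\<star>)"
    by (simp add: Et_def)
  also have "\<dots> = Et2 c d"
    unfolding 3 by (simp add: Et_def[of c])
  finally show ?thesis .
qed

lemma Ht_tensor: "Ht (c \<otimes> d) = rw (Dt c d) (c \<otimes> d) \<bullet> Ht2 c d"
  using mate_coeval[OF adj_Et2_Ht2 adj_Et_Ht, where f = "Dt c d" and g = "Id (c \<otimes> d)"] Et_tensor[of c d]
  by simp

lemma Et_unit: "Et \<one> = Ev \<one>"
proof -
  have "Et \<one> = (Ev (\<one>\<^sup>\<star>) \<bullet> rw (dual_arr (Ev \<one>)) (\<one>\<^sup>\<star>)) \<bullet> rw (Co \<one>) (\<one>\<^sup>\<star>)"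
    unfolding Et_def Piv_unit by simp
  also have "\<dots> = Ev \<one> \<bullet> lw (\<one>\<^sup>\<star>) (Ev \<one>) \<bullet> rw (Co \<one>) (\<one>\<^sup>\<star>)"
    by (subst dual_arr_eval[of _ _ \<one>]) simp_all
  also have "lw (\<one>\<^sup>\<star>) (Ev \<one>) \<bullet> rw (Co \<one>) (\<one>\<^sup>\<star>) = Co \<one> \<bullet> Ev \<one>"
    using exchange[of "Co \<one>" "Ev \<one>"] by simp
  also have "Ev \<one> \<bullet> Co \<one> \<bullet> Ev \<one> = Ev \<one>"
    using acomp_extend[OF Ev_unit_Co_unit, where w = "Ev \<one>"] by simp
  finally show ?thesis .
qed

text \<open>Both arrows are the name of \<open>Ev x\<close>: paired with the evaluation of the
  tensor product they give \<open>Ev x\<close>.\<close>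

lemma Dt_Co: "Dt (x\<^sup>\<star>) x \<bullet> Co (x\<^sup>\<star>) = dual_arr (Ev x) \<bullet> Co \<one>"
proof (rule eval_inj[OF adj_Ev_Co])
  let ?y = "x\<^sup>\<star> \<otimes> x"
  have "Ev ?y \<bullet> rw (Dt (x\<^sup>\<star>) x \<bullet> Co (x\<^sup>\<star>)) ?y = (Ev ?y \<bullet> rw (Dt (x\<^sup>\<star>) x) ?y) \<bullet> rw (Co (x\<^sup>\<star>)) ?y"
    by simp
  also have "\<dots> = Ev x"
    unfolding Dt_eval using adj_zigzag(1)[OF adj_Ev_Co, of \<one> "x\<^sup>\<star>" x] by simp
  finally have L: "Ev ?y \<bullet> rw (Dt (x\<^sup>\<star>) x \<bullet> Co (x\<^sup>\<star>)) ?y = Ev x" .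
  have "Ev ?y \<bullet> rw (dual_arr (Ev x) \<bullet> Co \<one>) ?y = (Ev ?y \<bullet> rw (dual_arr (Ev x)) ?y) \<bullet> rw (Co \<one>) ?y"
    by simp
  also have "\<dots> = Ev \<one> \<bullet> lw (\<one>\<^sup>\<star>) (Ev x) \<bullet> rw (Co \<one>) ?y"
    by (subst dual_arr_eval[of _ _ \<one>]) simp_all
  also have "lw (\<one>\<^sup>\<star>) (Ev x) \<bullet> rw (Co \<one>) ?y = Co \<one> \<bullet> Ev x"
    using exchange[of "Co \<one>" "Ev x"] by simp
  also have "Ev \<one> \<bullet> Co \<one> \<bullet> Ev x = Ev x"
    using acomp_extend[OF Ev_unit_Co_unit, where w = "Ev x"] by simp
  finally show "Ev ?y \<bullet> rw (Dt (x\<^sup>\<star>) x \<bullet> Co (x\<^sup>\<star>)) ?y = Ev ?y \<bullet> rw (dual_arr (Ev x) \<bullet> Co \<one>) ?y"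
    unfolding L by simp
qed simp_all

text \<open>In terms of \<open>a\<close>: its value at the dual of \<open>x\<close> is inverse to
  the dual of \<open>a x\<close>. This follows from naturality of \<open>Et\<close> along
  \<open>Ev x\<close>, whose target is the unit, where \<open>Et\<close> and \<open>Ev\<close>
  agree.\<close>

lemma Et_dual: "Et (x\<^sup>\<star>) \<bullet> lw (x\<^sup>\<star>) (Piv x) = Ev x"
proof -
  let ?y = "x\<^sup>\<star> \<otimes> x"
  \<comment> \<open>\<open>Piv x\<close> is \<open>Et x\<close> bent by a coevaluation; written so,
    it produces the nested \<open>Et2\<close> to which \<open>Et_tensor\<close> applies.\<close>
  have P: "rw (Et x) (x\<^sup>\<star>\<^sup>\<star>) \<bullet> lw x (Co (x\<^sup>\<star>)) = Piv x"
    unfolding Et_def by (rule transpose_of_eval[OF adj_Ev_Co]) simp_all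
  have "Et (x\<^sup>\<star>) \<bullet> lw (x\<^sup>\<star>) (Piv x) = (Et ?y \<bullet> lw ?y (Dt (x\<^sup>\<star>) x)) \<bullet> lw ?y (Co (x\<^sup>\<star>))"
    unfolding Et_tensor by (simp flip: P)
  also have "\<dots> = Et ?y \<bullet> lw ?y (Dt (x\<^sup>\<star>) x \<bullet> Co (x\<^sup>\<star>))" by simp
  also have "\<dots> = (Et ?y \<bullet> lw ?y (dual_arr (Ev x))) \<bullet> lw ?y (Co \<one>)"
    unfolding Dt_Co by simp
  also have "\<dots> = Et \<one> \<bullet> rw (Ev x) (\<one>\<^sup>\<star>) \<bullet> lw ?y (Co \<one>)"
    by (subst Et_natural[of _ _ \<one>, symmetric]) simp_all
  also have "rw (Ev x) (\<one>\<^sup>\<star>) \<bullet> lw ?y (Co \<one>) = Co \<one> \<bullet> Ev x"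
    using exchange[of "Ev x" "Co \<one>"] by simp
  also have "Et \<one> \<bullet> Co \<one> \<bullet> Ev x = Ev x"
    unfolding Et_unit using acomp_extend[OF Ev_unit_Co_unit, where w = "Ev x"] by simp
  finally show ?thesis .
qed

lemma Ht_dual: "Ht (x\<^sup>\<star>) = rw (Piv x) (x\<^sup>\<star>) \<bullet> Co x"
  using mate_coeval[OF adj_Ev_Co adj_Et_Ht, where f = "Piv x" and g = "Id (x\<^sup>\<star>)"] Et_dual by simp

text \<open>An arbitrary left dual \<open>x\<close> of \<open>c\<close>, transported to the right
  dual of \<open>c\<close>, yields the same coevaluation, so the left dimension is independent of
  the chosen left dual. Only evaluations have to be compared, and there \<open>Et_dual\<close>
  absorbs \<open>Piv x\<close>.\<close>

lemma Ht_from_left_dual: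
  assumes "adj x c e h"
  shows "rw (dual_arr (rw e (x\<^sup>\<star>) \<bullet> lw c (Co x)) \<bullet> Piv x) c \<bullet> h = Ht c"
proof -
  note [simp] = adjD(1-6)[OF assms(1)]
  define \<phi> where "\<phi> = rw e (x\<^sup>\<star>) \<bullet> lw c (Co x)"
  have [simp]: "arr \<phi>" "src \<phi> = c" "trg \<phi> = x\<^sup>\<star>" by (simp_all add: \<phi>_def)
  have "Et c \<bullet> lw c (dual_arr \<phi> \<bullet> Piv x) = (Et c \<bullet> lw c (dual_arr \<phi>)) \<bullet> lw c (Piv x)" by simp
  also have "\<dots> = Et (x\<^sup>\<star>) \<bullet> rw \<phi> (x\<^sup>\<star>\<^sup>\<star>) \<bullet> lw c (Piv x)"
    by (subst Et_natural[of _ _ "x\<^sup>\<star>", symmetric]) simp_all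
  also have "rw \<phi> (x\<^sup>\<star>\<^sup>\<star>) \<bullet> lw c (Piv x) = lw (x\<^sup>\<star>) (Piv x) \<bullet> rw \<phi> x"
    using exchange[of \<phi> "Piv x"] by simp
  also have "Et (x\<^sup>\<star>) \<bullet> lw (x\<^sup>\<star>) (Piv x) \<bullet> rw \<phi> x = Ev x \<bullet> rw \<phi> x"
    using acomp_extend[OF Et_dual, where w = "rw \<phi> x"] by simp
  also have "\<dots> = e"
    unfolding \<phi>_def by (rule transpose_eval[OF adj_Ev_Co]) simp_all
  finally show ?thesis
    using mate_coeval[OF assms adj_Et_Ht, where f = "dual_arr \<phi> \<bullet> Piv x" and g = "Id c"]
    by (simp flip: \<phi>_def)
qed

lemma left_dimension_map_eq: "left_dimension_map a c = mor (Ev c \<bullet> Ht c)"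
proof -
  define \<phi> where "\<phi> = rw (c \<otimes> \<^sup>\<star>c, ev' c, \<one>) ((\<^sup>\<star>c)\<^sup>\<star>) \<bullet> lw c (Co (\<^sup>\<star>c))"
  note L = dual_pair_adj[OF left_dual[of c]]
  have "arr \<phi>" "src \<phi> = c" "trg \<phi> = (\<^sup>\<star>c)\<^sup>\<star>"
    using adjD(1)[OF L] by (simp_all add: \<phi>_def)
  then have "mor (dual_arr \<phi>) = dual_map c ((\<^sup>\<star>c)\<^sup>\<star>) (dual_of_ldual c)"
    by (subst mor_dual_arr) (simp_all add: \<phi>_def dual_of_ldual_def)
  then have "left_dimension_map a c
      = mor (Ev c \<bullet> rw (dual_arr \<phi> \<bullet> Piv (\<^sup>\<star>c)) c \<bullet> (\<one>, coev' c, \<^sup>\<star>c \<otimes> c))"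
    unfolding left_dimension_map_def acomp_simps whisker_simps by simp
  then show ?thesis
    unfolding \<phi>_def Ht_from_left_dual[OF L] .
qed

section \<open>Left, right and partial traces\<close>

definition Ltr :: "('o, 'm) arrow \<Rightarrow> ('o, 'm) arrow" where
  "Ltr f = Ev (src f) \<bullet> lw ((src f)\<^sup>\<star>) f \<bullet> Ht (src f)"

definition Rtr :: "('o, 'm) arrow \<Rightarrow> ('o, 'm) arrow" where
  "Rtr f = Et (src f) \<bullet> rw f ((src f)\<^sup>\<star>) \<bullet> Co (src f)"

text \<open>The arrow \<open>g\<close> travels around the loop: it crosses the evaluation as its
  dual, passes \<open>f\<close> on the neighbouring strand and returns across the
  coevaluation.\<close>

lemma Ltr_cyclic:
  assumes "arr f" "src f = c" "trg f = d" "arr g" "src g = d" "trg g = c"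
  shows "Ltr (g \<bullet> f) = Ltr (f \<bullet> g)"
proof -
  note [simp] = assms
  have "Ltr (g \<bullet> f) = (Ev c \<bullet> lw (c\<^sup>\<star>) g) \<bullet> lw (c\<^sup>\<star>) f \<bullet> Ht c"
    by (simp add: Ltr_def)
  also have "\<dots> = Ev d \<bullet> (rw (dual_arr g) d \<bullet> lw (c\<^sup>\<star>) f) \<bullet> Ht c"
    by (subst dual_arr_eval[of g d c, symmetric]) simp_all
  also have "rw (dual_arr g) d \<bullet> lw (c\<^sup>\<star>) f = lw (d\<^sup>\<star>) f \<bullet> rw (dual_arr g) c"
    using exchange[of "dual_arr g" f] by simp
  also have "Ev d \<bullet> (lw (d\<^sup>\<star>) f \<bullet> rw (dual_arr g) c) \<bullet> Ht c = Ev d \<bullet> lw (d\<^sup>\<star>) f \<bullet> lw (d\<^sup>\<star>) g \<bullet> Ht d"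
    by (simp add: Ht_natural[of g d c])
  finally show ?thesis by (simp add: Ltr_def)
qed

lemma Rtr_cyclic:
  assumes "arr f" "src f = c" "trg f = d" "arr g" "src g = d" "trg g = c"
  shows "Rtr (g \<bullet> f) = Rtr (f \<bullet> g)"
proof -
  note [simp] = assms
  have "Rtr (g \<bullet> f) = (Et c \<bullet> rw g (c\<^sup>\<star>)) \<bullet> rw f (c\<^sup>\<star>) \<bullet> Co c"
    by (simp add: Rtr_def)
  also have "\<dots> = Et d \<bullet> (lw d (dual_arr g) \<bullet> rw f (c\<^sup>\<star>)) \<bullet> Co c"
    by (subst Et_natural[of g d c]) simp_all
  also have "lw d (dual_arr g) \<bullet> rw f (c\<^sup>\<star>) = rw f (d\<^sup>\<star>) \<bullet> lw c (dual_arr g)"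
    using exchange[of f "dual_arr g"] by simp
  also have "Et d \<bullet> (rw f (d\<^sup>\<star>) \<bullet> lw c (dual_arr g)) \<bullet> Co c = Et d \<bullet> rw f (d\<^sup>\<star>) \<bullet> rw g (d\<^sup>\<star>) \<bullet> Co d"
    by (simp add: dual_arr_coeval[of g d c])
  finally show ?thesis by (simp add: Rtr_def)
qed

definition ptr_left :: "'o \<Rightarrow> 'o \<Rightarrow> ('o, 'm) arrow \<Rightarrow> ('o, 'm) arrow" where
  "ptr_left c d h = rw (Ev c) d \<bullet> lw (c\<^sup>\<star>) h \<bullet> rw (Ht c) d"

definition ptr_right :: "'o \<Rightarrow> 'o \<Rightarrow> ('o, 'm) arrow \<Rightarrow> ('o, 'm) arrow" where
  "ptr_right c d h = lw c (Et d) \<bullet> rw h (d\<^sup>\<star>) \<bullet> lw c (Co d)"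

lemma ptr_simps [simp]:
  assumes "arr h" "src h = c \<otimes> d" "trg h = c \<otimes> d"
  shows "arr (ptr_left c d h)" "src (ptr_left c d h) = d" "trg (ptr_left c d h) = d"
    "arr (ptr_right c d h)" "src (ptr_right c d h) = c" "trg (ptr_right c d h) = c"
  using assms by (simp_all add: ptr_left_def ptr_right_def)

text \<open>The comparison map inside \<open>Ht (c \<otimes> d)\<close> slides past \<open>h\<close>
  and unfolds the evaluation into two nested loops, the inner one closing \<open>c\<close>.\<close>

lemma Ltr_ptr_left:
  assumes "arr h" "src h = c \<otimes> d" "trg h = c \<otimes> d"
  shows "Ltr h = Ltr (ptr_left c d h)"
proof -
  note [simp] = assms
  have "Ltr h = Ev (c \<otimes> d) \<bullet> (lw ((c \<otimes> d)\<^sup>\<star>) h \<bullet> rw (Dt c d) (c \<otimes> d)) \<bullet> Ht2 c d"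
    unfolding Ltr_def assms(2) Ht_tensor by simp
  also have "lw ((c \<otimes> d)\<^sup>\<star>) h \<bullet> rw (Dt c d) (c \<otimes> d) = rw (Dt c d) (c \<otimes> d) \<bullet> lw (d\<^sup>\<star> \<otimes> c\<^sup>\<star>) h"
    using exchange[of "Dt c d" h] by simp
  also have "Ev (c \<otimes> d) \<bullet> (rw (Dt c d) (c \<otimes> d) \<bullet> lw (d\<^sup>\<star> \<otimes> c\<^sup>\<star>) h) \<bullet> Ht2 c d
      = Ev2 c d \<bullet> lw (d\<^sup>\<star> \<otimes> c\<^sup>\<star>) h \<bullet> Ht2 c d"
    using acomp_extend[OF Dt_eval, where w = "lw (d\<^sup>\<star> \<otimes> c\<^sup>\<star>) h \<bullet> Ht2 c d"] by simp
  also have "\<dots> = Ltr (ptr_left c d h)"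
    by (simp add: Ltr_def) (simp add: ptr_left_def)
  finally show ?thesis .
qed

lemma Rtr_ptr_right:
  assumes "arr h" "src h = c \<otimes> d" "trg h = c \<otimes> d"
  shows "Rtr h = Rtr (ptr_right c d h)"
proof -
  note [simp] = assms
  have "Rtr h = Et (c \<otimes> d) \<bullet> (rw h ((c \<otimes> d)\<^sup>\<star>) \<bullet> lw (c \<otimes> d) (Dt c d)) \<bullet> Co2 c d"
    unfolding Rtr_def assms(2) Dt_coeval by simp
  also have "rw h ((c \<otimes> d)\<^sup>\<star>) \<bullet> lw (c \<otimes> d) (Dt c d) = lw (c \<otimes> d) (Dt c d) \<bullet> rw h (d\<^sup>\<star> \<otimes> c\<^sup>\<star>)"
    using exchange[of h "Dt c d"] by simp
  also have "Et (c \<otimes> d) \<bullet> (lw (c \<otimes> d) (Dt c d) \<bullet> rw h (d\<^sup>\<star> \<otimes> c\<^sup>\<star>)) \<bullet> Co2 c d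
      = Et2 c d \<bullet> rw h (d\<^sup>\<star> \<otimes> c\<^sup>\<star>) \<bullet> Co2 c d"
    using acomp_extend[OF Et_tensor, where w = "rw h (d\<^sup>\<star> \<otimes> c\<^sup>\<star>) \<bullet> Co2 c d"] by simp
  also have "\<dots> = Rtr (ptr_right c d h)"
    by (simp add: Rtr_def) (simp add: ptr_right_def)
  finally show ?thesis .
qed

text \<open>Both sides close \<open>c\<close> on the left and \<open>d\<close> on the right. The
  loops are disjoint, so their order is immaterial: the evaluations are exchanged with each other,
  and so are the coevaluations.\<close>

lemma Ltr_ptr_right:
  assumes "arr h" "src h = c \<otimes> d" "trg h = c \<otimes> d"
  shows "Ltr (ptr_right c d h) = Rtr (ptr_left c d h)"
proof -
  note [simp] = assms
  have 1: "Ev c \<bullet> lw (c\<^sup>\<star> \<otimes> c) (Et d) = Et d \<bullet> rw (Ev c) (d \<otimes> d\<^sup>\<star>)"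
    using exchange[of "Ev c" "Et d"] by simp
  have 2: "lw (c\<^sup>\<star> \<otimes> c) (Co d) \<bullet> Ht c = rw (Ht c) (d \<otimes> d\<^sup>\<star>) \<bullet> Co d"
    using exchange[of "Ht c" "Co d"] by simp
  have "Ltr (ptr_right c d h) = (Ev c \<bullet> lw (c\<^sup>\<star> \<otimes> c) (Et d)) \<bullet> lw (c\<^sup>\<star>) (rw h (d\<^sup>\<star>)) \<bullet> lw (c\<^sup>\<star> \<otimes> c) (Co d) \<bullet> Ht c"
    by (simp add: Ltr_def) (simp add: ptr_right_def)
  also have "\<dots> = Rtr (ptr_left c d h)"
    unfolding 1 2 by (simp add: Rtr_def) (simp add: ptr_left_def)
  finally show ?thesis .
qed

end

section \<open>Semisimplicity\<close>

text \<open>Stated for an indexed family because repeated vectors must count as dependent; hence the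
  separate case of a non-injective family.\<close>

lemma (in vector_space) exists_linear_relation:
  assumes "finite K" "finite B" "card B < card K" "\<And>k. k \<in> K \<Longrightarrow> v k \<in> span B"
  shows "\<exists>c. (\<exists>k\<in>K. c k \<noteq> 0) \<and> (\<Sum>k\<in>K. scale (c k) (v k)) = 0"
proof (cases "inj_on v K")
  case True
  then have "dependent (v ` K)"
    using independent_span_bound[of B "v ` K"] assms by (auto simp: card_image)
  then obtain u where u: "\<exists>w\<in>v ` K. u w \<noteq> 0" "(\<Sum>w\<in>v ` K. scale (u w) w) = 0"
    using dependent_finite[of "v ` K"] assms(1) by auto
  then show ?thesis
    using True by (intro exI[of _ "u \<circ> v"]) (auto simp: sum.reindex)
next
  case False
  then obtain i j where ij: "i \<in> K" "j \<in> K" "i \<noteq> j" "v i = v j"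
    by (auto simp: inj_on_def)
  define c where "c k = (if k = i then 1 else if k = j then - 1 else 0 :: 'a)" for k
  have "(\<Sum>k\<in>K. scale (c k) (v k)) = (\<Sum>k\<in>{i, j}. scale (c k) (v k))"
    using assms(1) ij by (intro sum.mono_neutral_right) (auto simp: c_def)
  also have "\<dots> = 0"
    using ij by (simp add: c_def)
  finally show ?thesis
    using ij(1) by (intro exI[of _ c]) (auto simp: c_def)
qed

sublocale linear_category \<subseteq> vs: vector_space "smul C"
  by (rule vector_space_smul)

context linear_category
begin

lemma zero_Hom [simp]: "0 \<in> Hom C x y"
  using vs.subspace_0[OF subspace_Hom] .

lemma diff_Hom: "f \<in> Hom C x y \<Longrightarrow> g \<in> Hom C x y \<Longrightarrow> f - g \<in> Hom C x y"
  using vs.subspace_diff[OF subspace_Hom] .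

lemma smul_Hom: "f \<in> Hom C x y \<Longrightarrow> smul C z f \<in> Hom C x y"
  using vs.subspace_scale[OF subspace_Hom] .

lemma sum_Hom: "(\<And>k. k \<in> A \<Longrightarrow> f k \<in> Hom C x y) \<Longrightarrow> (\<Sum>k\<in>A. f k) \<in> Hom C x y"
  using vs.subspace_sum[OF subspace_Hom] .

lemma comp_zero_left: "f \<in> Hom C x y \<Longrightarrow> 0 \<cdot> f = 0"
  using comp_add_left[of f x y 0 y 0] by simp

lemma comp_zero_right: "g \<in> Hom C y z \<Longrightarrow> g \<cdot> 0 = 0"
  using comp_add_right[of 0 y y 0 g z] by simp

lemma comp_diff_right:
  assumes "f \<in> Hom C x y" "g \<in> Hom C x y" "h \<in> Hom C y z"
  shows "h \<cdot> (f - g) = h \<cdot> f - h \<cdot> g"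
  using comp_add_right[OF diff_Hom[OF assms(1,2)] assms(2,3)] by (simp add: algebra_simps)

lemma comp_diff_left:
  assumes "f \<in> Hom C x y" "g \<in> Hom C y z" "h \<in> Hom C y z"
  shows "(g - h) \<cdot> f = g \<cdot> f - h \<cdot> f"
  using comp_add_left[OF assms(1) diff_Hom[OF assms(2,3)] assms(3)] by (simp add: algebra_simps)

lemma comp_sum_left:
  assumes "f \<in> Hom C x y" "\<And>k. k \<in> A \<Longrightarrow> g k \<in> Hom C y z"
  shows "(\<Sum>k\<in>A. g k) \<cdot> f = (\<Sum>k\<in>A. g k \<cdot> f)"
  using assms(2)
proof (induction A rule: infinite_finite_induct)
  case (insert k A)
  have "(g k + sum g A) \<cdot> f = g k \<cdot> f + sum g A \<cdot> f"
    using insert.prems by (intro comp_add_left[OF assms(1)]) (auto intro: sum_Hom)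
  then show ?case using insert by simp
qed (simp_all add: comp_zero_left[OF assms(1)])

lemma comp_sum_right:
  assumes "g \<in> Hom C y z" "\<And>k. k \<in> A \<Longrightarrow> f k \<in> Hom C x y"
  shows "g \<cdot> (\<Sum>k\<in>A. f k) = (\<Sum>k\<in>A. g \<cdot> f k)"
  using assms(2)
proof (induction A rule: infinite_finite_induct)
  case (insert k A)
  have "g \<cdot> (f k + sum f A) = g \<cdot> f k + g \<cdot> sum f A"
    using insert.prems by (intro comp_add_right[OF _ _ assms(1)]) (auto intro: sum_Hom)
  then show ?case using insert by simp
qed (simp_all add: comp_zero_right[OF assms(1)])

lemma iso_Hom: "iso x y f \<Longrightarrow> f \<in> Hom C x y"
  by (simp add: iso_def)

lemma comp_regroup:
  assumes "f \<in> Hom C v w" "g \<in> Hom C w x" "h \<in> Hom C x y" "k \<in> Hom C y z"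
  shows "(k \<cdot> h) \<cdot> g \<cdot> f = k \<cdot> (h \<cdot> g) \<cdot> f"
  using comp_assoc[OF comp_Hom[OF assms(1,2)] assms(3,4)] comp_assoc[OF assms(1-3)] by simp

lemma isomorphic_refl: "isomorphic x x"
  unfolding isomorphic_def iso_def
  using ident_Hom comp_ident[OF ident_Hom] by blast

lemma isomorphic_sym: "isomorphic x y \<Longrightarrow> isomorphic y x"
  unfolding isomorphic_def iso_def by blast

lemma isomorphic_trans:
  assumes "isomorphic x y" "isomorphic y z"
  shows "isomorphic x z"
proof -
  obtain f f' where f: "f \<in> Hom C x y" "f' \<in> Hom C y x" "f' \<cdot> f = \<iota> x" "f \<cdot> f' = \<iota> y"
    using assms(1) by (auto simp: isomorphic_def iso_def)
  obtain g g' where g: "g \<in> Hom C y z" "g' \<in> Hom C z y" "g' \<cdot> g = \<iota> y" "g \<cdot> g' = \<iota> z"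
    using assms(2) by (auto simp: isomorphic_def iso_def)
  have "(f' \<cdot> g') \<cdot> g \<cdot> f = \<iota> x"
    using comp_regroup[OF f(1) g(1,2) f(2)] g(3) f(3) ident_comp[OF f(1)] by simp
  moreover have "(g \<cdot> f) \<cdot> f' \<cdot> g' = \<iota> z"
    using comp_regroup[OF g(2) f(2,1) g(1)] f(4) g(4) ident_comp[OF g(2)] by simp
  ultimately show ?thesis
    unfolding isomorphic_def iso_def using comp_Hom[OF f(1) g(1)] comp_Hom[OF g(2) f(2)] by blast
qed

lemma simple_ident_nonzero:
  assumes "simple s"
  shows "\<iota> s \<noteq> 0"
proof
  assume 0: "\<iota> s = 0"
  have "f = 0" if "f \<in> Hom C x s" for f x
    using ident_comp[OF that] comp_zero_left[OF that] 0 by simp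
  moreover have "f = 0" if "f \<in> Hom C s x" for f x
    using comp_ident[OF that] comp_zero_right[OF that] 0 by simp
  ultimately have "zero_object s"
    by (auto simp: zero_object_def)
  then show False using assms by (simp add: simple_def)
qed

lemma simple_scalar_inject:
  assumes "simple s" "smul C z (\<iota> s) = smul C w (\<iota> s)"
  shows "z = w"
  using assms simple_ident_nonzero by (simp add: vs.scale_right_imp_eq vs.scale_cancel_right)

section \<open>Polynomials in an endomorphism\<close>

primrec End_power :: "'o \<Rightarrow> 'm \<Rightarrow> nat \<Rightarrow> 'm" where
  "End_power s f 0 = \<iota> s"
| "End_power s f (Suc n) = f \<cdot> End_power s f n"

lemma End_power_Hom: "f \<in> Hom C s s \<Longrightarrow> End_power s f n \<in> Hom C s s"
  by (induction n) (auto intro: ident_Hom comp_Hom)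

definition End_poly :: "'o \<Rightarrow> 'm \<Rightarrow> complex poly \<Rightarrow> 'm" where
  "End_poly s f p = (\<Sum>i\<le>degree p. smul C (coeff p i) (End_power s f i))"

lemma End_poly_bound:
  "degree p \<le> n \<Longrightarrow> End_poly s f p = (\<Sum>i\<le>n. smul C (coeff p i) (End_power s f i))"
  unfolding End_poly_def by (rule sum.mono_neutral_left) (auto simp: coeff_eq_0)

lemma End_poly_Hom: "f \<in> Hom C s s \<Longrightarrow> End_poly s f p \<in> Hom C s s"
  unfolding End_poly_def by (intro sum_Hom smul_Hom End_power_Hom)

lemma End_poly_linear_factor:
  assumes f: "f \<in> Hom C s s"
  shows "End_poly s f ([:- z, 1:] * q) = (f - smul C z (\<iota> s)) \<cdot> End_poly s f q"
proof -
  define n where "n = degree q"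
  have "degree ([:- z, 1:] * q) \<le> Suc n"
    using degree_mult_le[of "[:- z, 1:]" q] by (simp add: n_def)
  \<comment> \<open>Both sums run to \<open>Suc n\<close>, so that multiplication by the variable is
    the shift \<open>pCons 0\<close>; the additional coefficient of \<open>q\<close> is
    zero.\<close>
  then have "End_poly s f ([:- z, 1:] * q)
      = (\<Sum>i\<le>Suc n. smul C (coeff (pCons 0 q) i) (End_power s f i) - smul C z (smul C (coeff q i) (End_power s f i)))"
    by (subst End_poly_bound) (auto simp: vs.scale_left_diff_distrib intro!: sum.cong)
  also have "\<dots> = (\<Sum>i\<le>Suc n. smul C (coeff (pCons 0 q) i) (End_power s f i))
      - smul C z (\<Sum>i\<le>Suc n. smul C (coeff q i) (End_power s f i))"
    by (simp only: sum_subtractf vs.scale_sum_right)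
  also have "(\<Sum>i\<le>Suc n. smul C (coeff q i) (End_power s f i)) = End_poly s f q"
    by (rule End_poly_bound[symmetric]) (simp add: n_def)
  also have "(\<Sum>i\<le>Suc n. smul C (coeff (pCons 0 q) i) (End_power s f i))
      = (\<Sum>i\<le>n. f \<cdot> smul C (coeff q i) (End_power s f i))"
    by (simp add: sum.atMost_Suc_shift comp_smul_right[OF End_power_Hom[OF f] f] del: sum.atMost_Suc)
  also have "\<dots> = f \<cdot> End_poly s f q"
    unfolding End_poly_def n_def
    by (rule comp_sum_right[where x = s, symmetric, OF f]) (intro smul_Hom End_power_Hom f)
  also have "smul C z (End_poly s f q) = smul C z (\<iota> s) \<cdot> End_poly s f q"
    using comp_smul_left[OF End_poly_Hom[OF f] ident_Hom] ident_comp[OF End_poly_Hom[OF f]] by simp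
  finally show ?thesis
    using comp_diff_left[OF End_poly_Hom[OF f] f smul_Hom[OF ident_Hom]] by simp
qed

end

section \<open>Schur's lemma\<close>

context fusion_category
begin

text \<open>The kernel of \<open>f\<close> is a mono into \<open>s\<close>, hence everything or
  zero. The former would give \<open>f = 0\<close>; in the latter case \<open>f\<close> is itself a
  mono, from a nonzero object into the simple object \<open>t\<close>.\<close>

lemma schur:
  assumes "simple s" "simple t" and f: "f \<in> Hom C s t" and "f \<noteq> 0"
  shows "iso s t f"
proof -
  obtain n k where ker: "kernel s t f n k"
    using abelian f unfolding abelian_def by meson
  then have k: "k \<in> Hom C n s" "f \<cdot> k = 0"
    and lift: "\<And>w g. g \<in> Hom C w s \<Longrightarrow> f \<cdot> g = 0 \<Longrightarrow> \<exists>!h. h \<in> Hom C w n \<and> k \<cdot> h = g"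
    by (auto simp: kernel_def)
  have "mono n s k"
    unfolding mono_def
  proof (intro conjI allI ballI impI)
    fix w g h assume g: "g \<in> Hom C w n" and h: "h \<in> Hom C w n" and eq: "k \<cdot> g = k \<cdot> h"
    have "f \<cdot> k \<cdot> g = 0"
      using comp_assoc[OF g k(1) f] comp_zero_left[OF g] k(2) by simp
    from lift[OF comp_Hom[OF g k(1)] this] show "g = h"
      using g h eq by auto
  qed (rule k)
  then consider "iso n s k" | "zero_object n"
    using assms(1) by (auto simp: simple_def)
  then have "mono s t f"
  proof cases
    case 1
    then obtain j where j: "j \<in> Hom C s n" "k \<cdot> j = \<iota> s" by (auto simp: iso_def)
    have "f = (f \<cdot> k) \<cdot> j"
      using comp_assoc[OF j(1) k(1) f] j(2) comp_ident[OF f] by simp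
    then have "f = 0" using k(2) comp_zero_left[OF j(1)] by simp
    then show ?thesis using assms(4) by simp
  next
    case 2
    show ?thesis
      unfolding mono_def
    proof (intro conjI allI ballI impI)
      fix w g h assume gh: "g \<in> Hom C w s" "h \<in> Hom C w s" "f \<cdot> g = f \<cdot> h"
      then have "f \<cdot> (g - h) = 0"
        using comp_diff_right[OF gh(1,2) f] by simp
      from lift[OF diff_Hom[OF gh(1,2)] this] obtain u where "u \<in> Hom C w n" "k \<cdot> u = g - h"
        by auto
      then show "g = h"
        using 2 comp_zero_right[OF k(1)] by (auto simp: zero_object_def)
    qed (rule f)
  qed
  then show ?thesis
    using assms(1,2) by (auto simp: simple_def)
qed

text \<open>Some nonzero polynomial annihilates \<open>f\<close> and, unless constant, has a complex
  root. By Schur's lemma its linear factor either vanishes at \<open>f\<close>, which makes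
  \<open>f\<close> a scalar, or is invertible there and can be cancelled, which lowers the
  degree.\<close>

lemma End_simple_scalar:
  assumes "simple s" and f: "f \<in> Hom C s s"
  shows "\<exists>z. f = smul C z (\<iota> s)"
proof -
  obtain B where B: "finite B" "vs.span B = Hom C s s"
    using finite_dimensional_Homs unfolding finite_dimensional_Homs_def by meson
  \<comment> \<open>The exponents from 0 to \<open>card B\<close> are one more than the elements of
    the spanning set.\<close>
  obtain c where c: "\<exists>i\<in>{..card B}. c i \<noteq> 0" "(\<Sum>i\<le>card B. smul C (c i) (End_power s f i)) = 0"
    using vs.exists_linear_relation[of "{..card B}" B "End_power s f"] B End_power_Hom[OF f] by auto
  define p where "p = (\<Sum>i\<le>card B. monom (c i) i)"
  have coeff_p: "coeff p i = (if i \<le> card B then c i else 0)" for i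
    by (simp add: p_def coeff_sum)
  have "degree p \<le> card B"
    by (intro degree_le) (simp add: coeff_p)
  then have "End_poly s f p = 0"
    using c(2) by (simp add: End_poly_bound[of _ "card B"] coeff_p)
  moreover have "p \<noteq> 0"
    using c(1) coeff_p by (metis atMost_iff coeff_0)
  ultimately show ?thesis
  proof (induction "degree p" arbitrary: p rule: less_induct)
    case less
    show ?case
    proof (cases "degree p = 0")
      case True
      then obtain z where "p = [:z:]" by (rule degree_eq_zeroE)
      then show ?thesis
        using less.prems simple_ident_nonzero[OF assms(1)] by (simp add: End_poly_def)
    next
      case False
      then have "\<not> constant (poly p)" by (simp add: constant_degree)
      then obtain z where "poly p z = 0"
        using fundamental_theorem_of_algebra by blast
      then have "[:- z, 1:] dvd p" by (simp add: poly_eq_0_iff_dvd)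
      then obtain q where q: "p = [:- z, 1:] * q" by (rule dvdE)
      with less.prems(2) have "q \<noteq> 0" by auto
      let ?g = "f - smul C z (\<iota> s)"
      have g: "?g \<in> Hom C s s" by (intro diff_Hom f smul_Hom ident_Hom)
      have gq: "?g \<cdot> End_poly s f q = 0"
        using less.prems(1) unfolding q End_poly_linear_factor[OF f] .
      show ?thesis
      proof (cases "?g = 0")
        case True
        then show ?thesis by auto
      next
        case False
        from schur[OF assms(1,1) g this] obtain j where j: "j \<in> Hom C s s" "j \<cdot> ?g = \<iota> s"
          by (auto simp: iso_def)
        have "End_poly s f q = j \<cdot> ?g \<cdot> End_poly s f q"
          using comp_assoc[OF End_poly_Hom[OF f] g j(1)] j(2) ident_comp[OF End_poly_Hom[OF f]] by simp
        then have "End_poly s f q = 0"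
          using gq comp_zero_right[OF j(1)] by simp
        moreover have "degree q < degree p"
          using \<open>q \<noteq> 0\<close> unfolding q by (subst degree_mult_eq) auto
        ultimately show ?thesis
          using less.hyps \<open>q \<noteq> 0\<close> by blast
      qed
    qed
  qed
qed

definition scalar :: "'m \<Rightarrow> complex" where
  "scalar t = (THE z. t = smul C z (\<iota> \<one>))"

lemma scalar_eqI: "t = smul C z (\<iota> \<one>) \<Longrightarrow> scalar t = z"
  unfolding scalar_def using simple_scalar_inject[OF simple_unit] by blast

lemma scalar_smul_ident: "t \<in> Hom C \<one> \<one> \<Longrightarrow> smul C (scalar t) (\<iota> \<one>) = t"
  using End_simple_scalar[OF simple_unit] scalar_eqI by metis

lemma scalar_add: "t \<in> Hom C \<one> \<one> \<Longrightarrow> u \<in> Hom C \<one> \<one> \<Longrightarrow> scalar (t + u) = scalar t + scalar u"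
  by (rule scalar_eqI) (simp add: vs.scale_left_distrib scalar_smul_ident)

lemma scalar_smul: "t \<in> Hom C \<one> \<one> \<Longrightarrow> scalar (smul C z t) = z * scalar t"
  by (rule scalar_eqI) (simp add: scalar_smul_ident flip: vs.scale_scale)

section \<open>Decompositions and automorphisms of the identity functor\<close>

definition decomposition :: "'o \<Rightarrow> nat \<times> (nat \<Rightarrow> 'o) \<times> (nat \<Rightarrow> 'm) \<times> (nat \<Rightarrow> 'm)" where
  "decomposition x = (SOME (n, s, i, p). direct_sum x n s i p \<and> (\<forall>k<n. simple (s k)))"

definition len :: "'o \<Rightarrow> nat" where "len x = fst (decomposition x)"
definition summand :: "'o \<Rightarrow> nat \<Rightarrow> 'o" where "summand x = fst (snd (decomposition x))"
definition incl :: "'o \<Rightarrow> nat \<Rightarrow> 'm" where "incl x = fst (snd (snd (decomposition x)))"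
definition prj :: "'o \<Rightarrow> nat \<Rightarrow> 'm" where "prj x = snd (snd (snd (decomposition x)))"

lemma decomposition:
  "direct_sum x (len x) (summand x) (incl x) (prj x) \<and> (\<forall>k<len x. simple (summand x k))"
proof -
  obtain n s i p where "direct_sum x n s i p \<and> (\<forall>k<n. simple (s k))"
    using semisimple unfolding semisimple_def by blast
  then have "case (n, s, i, p) of (n, s, i, p) \<Rightarrow> direct_sum x n s i p \<and> (\<forall>k<n. simple (s k))"
    by simp
  then have "case decomposition x of (n, s, i, p) \<Rightarrow> direct_sum x n s i p \<and> (\<forall>k<n. simple (s k))"
    unfolding decomposition_def by (rule someI)
  then show ?thesis
    by (simp add: len_def summand_def incl_def prj_def split_beta)
qed

lemma
  shows incl_Hom: "k < len x \<Longrightarrow> incl x k \<in> Hom C (summand x k) x"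
    and prj_Hom: "k < len x \<Longrightarrow> prj x k \<in> Hom C x (summand x k)"
    and simple_summand: "k < len x \<Longrightarrow> simple (summand x k)"
    and prj_incl: "k < len x \<Longrightarrow> l < len x \<Longrightarrow> prj x k \<cdot> incl x l = (if k = l then \<iota> (summand x k) else 0)"
    and sum_incl_prj: "(\<Sum>k<len x. incl x k \<cdot> prj x k) = \<iota> x"
  using decomposition[of x] by (auto simp: direct_sum_def)

lemma expand_left:
  assumes "f \<in> Hom C x y"
  shows "f = (\<Sum>k<len y. incl y k \<cdot> prj y k \<cdot> f)"
proof -
  have "f = (\<Sum>k<len y. incl y k \<cdot> prj y k) \<cdot> f"
    using ident_comp[OF assms] sum_incl_prj by simp
  also have "\<dots> = (\<Sum>k<len y. (incl y k \<cdot> prj y k) \<cdot> f)"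
    by (rule comp_sum_left[OF assms]) (auto intro: comp_Hom incl_Hom prj_Hom)
  also have "\<dots> = (\<Sum>k<len y. incl y k \<cdot> prj y k \<cdot> f)"
    by (intro sum.cong refl comp_assoc[OF assms prj_Hom incl_Hom]) auto
  finally show ?thesis .
qed

lemma expand_right:
  assumes "f \<in> Hom C x y"
  shows "f = (\<Sum>k<len x. (f \<cdot> incl x k) \<cdot> prj x k)"
proof -
  have "f = f \<cdot> (\<Sum>k<len x. incl x k \<cdot> prj x k)"
    using comp_ident[OF assms] sum_incl_prj by simp
  also have "\<dots> = (\<Sum>k<len x. f \<cdot> incl x k \<cdot> prj x k)"
    by (rule comp_sum_right[OF assms]) (auto intro: comp_Hom incl_Hom prj_Hom)
  also have "\<dots> = (\<Sum>k<len x. (f \<cdot> incl x k) \<cdot> prj x k)"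
    by (intro sum.cong refl comp_assoc[OF prj_Hom incl_Hom assms, symmetric]) auto
  finally show ?thesis .
qed

text \<open>
  If \<open>\<nu>\<close> is invariant under isomorphism, this is the natural endomorphism of the identity functor that
  acts on each simple object \<open>s\<close> as the scalar \<open>\<nu> s\<close>.
\<close>

definition spread :: "('o \<Rightarrow> complex) \<Rightarrow> 'o \<Rightarrow> 'm" where
  "spread \<nu> x = (\<Sum>k<len x. smul C (\<nu> (summand x k)) (incl x k \<cdot> prj x k))"

lemma spread_Hom: "spread \<nu> x \<in> Hom C x x"
  unfolding spread_def by (intro sum_Hom smul_Hom comp_Hom[OF prj_Hom incl_Hom]) auto

text \<open>By Schur's lemma \<open>f\<close> meets only summands of \<open>x\<close> isomorphic to
  \<open>s\<close>, and these all carry the same scalar. Naturality of \<open>spread\<close> follows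
  by testing on the simple summands of the source.\<close>

lemma spread_comp_simple:
  assumes inv: "\<And>s t. simple s \<Longrightarrow> simple t \<Longrightarrow> isomorphic s t \<Longrightarrow> \<nu> s = \<nu> t"
    and s: "simple s" and f: "f \<in> Hom C s x"
  shows "spread \<nu> x \<cdot> f = smul C (\<nu> s) f"
proof -
  have "smul C (\<nu> (summand x k)) (incl x k \<cdot> prj x k) \<cdot> f = smul C (\<nu> s) (incl x k \<cdot> prj x k \<cdot> f)"
    if k: "k < len x" for k
  proof -
    note H = incl_Hom[OF k] prj_Hom[OF k]
    have "smul C (\<nu> (summand x k)) (incl x k \<cdot> prj x k) \<cdot> f = smul C (\<nu> (summand x k)) (incl x k \<cdot> prj x k \<cdot> f)"
      using comp_smul_left[OF f comp_Hom[OF H(2,1)]] comp_assoc[OF f H(2,1)] by simp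
    moreover have "\<nu> (summand x k) = \<nu> s" if "prj x k \<cdot> f \<noteq> 0"
      using schur[OF s simple_summand[OF k] comp_Hom[OF f H(2)] that] inv[OF s simple_summand[OF k]]
      unfolding isomorphic_def by metis
    moreover have "incl x k \<cdot> prj x k \<cdot> f = 0" if "prj x k \<cdot> f = 0"
      using that comp_zero_right[OF H(1)] by simp
    ultimately show ?thesis by (cases "prj x k \<cdot> f = 0") simp_all
  qed
  then have "spread \<nu> x \<cdot> f = (\<Sum>k<len x. smul C (\<nu> s) (incl x k \<cdot> prj x k \<cdot> f))"
    unfolding spread_def
    by (subst comp_sum_left[OF f]) (auto intro!: sum.cong smul_Hom comp_Hom[OF prj_Hom incl_Hom])
  also have "\<dots> = smul C (\<nu> s) f"
    using expand_left[OF f] by (simp flip: vs.scale_sum_right)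
  finally show ?thesis .
qed

lemma spread_simple:
  assumes "\<And>s t. simple s \<Longrightarrow> simple t \<Longrightarrow> isomorphic s t \<Longrightarrow> \<nu> s = \<nu> t" "simple s"
  shows "spread \<nu> s = smul C (\<nu> s) (\<iota> s)"
  using spread_comp_simple[OF assms ident_Hom] comp_ident[OF spread_Hom] by simp

lemma spread_natural:
  assumes inv: "\<And>s t. simple s \<Longrightarrow> simple t \<Longrightarrow> isomorphic s t \<Longrightarrow> \<nu> s = \<nu> t"
    and f: "f \<in> Hom C x y"
  shows "spread \<nu> y \<cdot> f = f \<cdot> spread \<nu> x"
proof -
  have "spread \<nu> y \<cdot> f = (\<Sum>k<len x. ((spread \<nu> y \<cdot> f) \<cdot> incl x k) \<cdot> prj x k)"
    by (rule expand_right[OF comp_Hom[OF f spread_Hom]])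
  also have "\<dots> = (\<Sum>k<len x. f \<cdot> smul C (\<nu> (summand x k)) (incl x k \<cdot> prj x k))"
  proof (rule sum.cong)
    fix k assume "k \<in> {..<len x}"
    then have k: "k < len x" by simp
    note H = incl_Hom[OF k] prj_Hom[OF k]
    have "(spread \<nu> y \<cdot> f) \<cdot> incl x k = smul C (\<nu> (summand x k)) (f \<cdot> incl x k)"
      using comp_assoc[OF H(1) f spread_Hom] spread_comp_simple[where \<nu> = \<nu>, OF inv simple_summand[OF k] comp_Hom[OF H(1) f]]
      by simp
    then show "((spread \<nu> y \<cdot> f) \<cdot> incl x k) \<cdot> prj x k = f \<cdot> smul C (\<nu> (summand x k)) (incl x k \<cdot> prj x k)"
      using comp_smul_left[OF H(2) comp_Hom[OF H(1) f]] comp_smul_right[OF comp_Hom[OF H(2,1)] f]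
        comp_assoc[OF H(2,1) f] by simp
  qed simp
  also have "\<dots> = f \<cdot> spread \<nu> x"
    unfolding spread_def
    by (rule comp_sum_right[OF f, symmetric]) (auto intro!: smul_Hom comp_Hom[OF prj_Hom incl_Hom])
  finally show ?thesis .
qed

lemma spread_inverse:
  assumes inv: "\<And>s t. simple s \<Longrightarrow> simple t \<Longrightarrow> isomorphic s t \<Longrightarrow> \<nu> s = \<nu> t"
    and "\<And>s. simple s \<Longrightarrow> \<nu> s * \<mu> s = 1"
  shows "spread \<nu> x \<cdot> spread \<mu> x = \<iota> x"
proof -
  have "spread \<nu> x \<cdot> smul C (\<mu> (summand x k)) (incl x k \<cdot> prj x k) = incl x k \<cdot> prj x k"
    if k: "k < len x" for k
  proof -
    note H = incl_Hom[OF k] prj_Hom[OF k]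
    have "spread \<nu> x \<cdot> smul C (\<mu> (summand x k)) (incl x k \<cdot> prj x k)
        = smul C (\<mu> (summand x k)) ((spread \<nu> x \<cdot> incl x k) \<cdot> prj x k)"
      using comp_smul_right[OF comp_Hom[OF H(2,1)] spread_Hom] comp_assoc[OF H(2,1) spread_Hom] by simp
    also have "\<dots> = smul C (\<nu> (summand x k) * \<mu> (summand x k)) (incl x k \<cdot> prj x k)"
      using spread_comp_simple[where \<nu> = \<nu>, OF inv simple_summand[OF k] H(1)] comp_smul_left[OF H(2,1)]
      by (simp add: mult.commute)
    finally show ?thesis
      using assms(2)[OF simple_summand[OF k]] by simp
  qed
  then show ?thesis
    unfolding spread_def[of \<mu>]
    by (subst comp_sum_right[OF spread_Hom])
       (auto simp: sum_incl_prj intro!: smul_Hom comp_Hom[OF prj_Hom incl_Hom])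
qed

lemma tensor_sum_left:
  assumes "g \<in> Hom C z w" "\<And>k. k \<in> A \<Longrightarrow> f k \<in> Hom C x y"
  shows "(\<Sum>k\<in>A. f k) \<odot> g = (\<Sum>k\<in>A. f k \<odot> g)"
  using assms(2)
proof (induction A rule: infinite_finite_induct)
  case (insert k A)
  have "(f k + sum f A) \<odot> g = f k \<odot> g + sum f A \<odot> g"
    using insert.prems by (intro tensor_add_left[OF _ _ assms(1)]) (auto intro: sum_Hom)
  then show ?case using insert by simp
qed (use tensor_add_left[OF zero_Hom[of x y] zero_Hom assms(1)] in simp_all)

lemma tensor_sum_right:
  assumes "f \<in> Hom C x y" "\<And>k. k \<in> A \<Longrightarrow> g k \<in> Hom C z w"
  shows "f \<odot> (\<Sum>k\<in>A. g k) = (\<Sum>k\<in>A. f \<odot> g k)"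
  using assms(2)
proof (induction A rule: infinite_finite_induct)
  case (insert k A)
  have "f \<odot> (g k + sum g A) = f \<odot> g k + f \<odot> sum g A"
    using insert.prems by (intro tensor_add_right[OF assms(1)]) (auto intro: sum_Hom)
  then show ?case using insert by simp
qed (use tensor_add_right[OF assms(1) zero_Hom[of z w] zero_Hom] in simp_all)

text \<open>The assumption \<open>mult\<close> is multiplicativity along fusion: \<open>i\<close>
  and \<open>p\<close> exhibit \<open>u\<close> as a direct summand of \<open>s \<otimes> t\<close>.
  Naturality along tensor products of inclusions reduces the claim to two simple objects.\<close>

lemma spread_tensor:
  assumes inv: "\<And>s t. simple s \<Longrightarrow> simple t \<Longrightarrow> isomorphic s t \<Longrightarrow> \<nu> s = \<nu> t"
    and mult: "\<And>s t u i p. \<lbrakk>simple s; simple t; simple u; i \<in> Hom C u (s \<otimes> t); p \<in> Hom C (s \<otimes> t) u;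
      p \<cdot> i = \<iota> u\<rbrakk> \<Longrightarrow> \<nu> u = \<nu> s * \<nu> t"
  shows "spread \<nu> (x \<otimes> y) = spread \<nu> x \<odot> spread \<nu> y"
proof -
  \<comment> \<open>All simple summands of \<open>s \<otimes> t\<close> carry the same scalar, so
    the chosen decomposition no longer matters.\<close>
  have simples: "spread \<nu> (s \<otimes> t) = smul C (\<nu> s * \<nu> t) (\<iota> (s \<otimes> t))" if "simple s" "simple t" for s t
  proof -
    have "\<nu> (summand (s \<otimes> t) k) = \<nu> s * \<nu> t" if k: "k < len (s \<otimes> t)" for k
      using mult[OF \<open>simple s\<close> \<open>simple t\<close> simple_summand[OF k] incl_Hom[OF k] prj_Hom[OF k]] prj_incl[OF k k]
      by simp
    then have "spread \<nu> (s \<otimes> t) = (\<Sum>k<len (s \<otimes> t). smul C (\<nu> s * \<nu> t) (incl (s \<otimes> t) k \<cdot> prj (s \<otimes> t) k))"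
      unfolding spread_def by (intro sum.cong) simp_all
    then show ?thesis
      by (simp only: vs.scale_sum_right[symmetric] sum_incl_prj)
  qed
  define e where "e x k = incl x k \<cdot> prj x k" for x k
  have e: "e x k \<in> Hom C x x" if "k < len x" for x k
    using comp_Hom[OF prj_Hom incl_Hom] that by (simp add: e_def)
  have piece: "spread \<nu> (x \<otimes> y) \<cdot> (e x k \<odot> e y l)
      = smul C (\<nu> (summand x k)) (e x k) \<odot> smul C (\<nu> (summand y l)) (e y l)"
    if k: "k < len x" and l: "l < len y" for k l
  proof -
    let ?i = "incl x k \<odot> incl y l" and ?p = "prj x k \<odot> prj y l"
    let ?s = "summand x k" and ?t = "summand y l"
    have i: "?i \<in> Hom C (?s \<otimes> ?t) (x \<otimes> y)" and p: "?p \<in> Hom C (x \<otimes> y) (?s \<otimes> ?t)"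
      using tensor_Hom incl_Hom prj_Hom k l by auto
    have ee: "e x k \<odot> e y l = ?i \<cdot> ?p"
      unfolding e_def
      by (rule interchange[OF prj_Hom[OF k] incl_Hom[OF k] prj_Hom[OF l] incl_Hom[OF l]])
    have "spread \<nu> (x \<otimes> y) \<cdot> (e x k \<odot> e y l) = (?i \<cdot> spread \<nu> (?s \<otimes> ?t)) \<cdot> ?p"
      unfolding ee using comp_assoc[OF p i spread_Hom[of \<nu>]] spread_natural[where \<nu> = \<nu>, OF inv i] by simp
    also have "\<dots> = smul C (\<nu> ?s * \<nu> ?t) (e x k \<odot> e y l)"
      using simples[OF simple_summand[OF k] simple_summand[OF l]] comp_smul_right[OF ident_Hom i]
        comp_ident[OF i] comp_smul_left[OF p i] ee by simp
    also have "\<dots> = smul C (\<nu> ?s) (e x k) \<odot> smul C (\<nu> ?t) (e y l)"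
      using tensor_smul_left[OF e[OF k] smul_Hom[OF e[OF l]]] tensor_smul_right[OF e[OF k] e[OF l]] by simp
    finally show ?thesis .
  qed
  \<comment> \<open>The products of the idempotents of \<open>x\<close> and \<open>y\<close> resolve
    the identity, so knowing \<open>spread\<close> on each of them suffices.\<close>
  have "\<iota> (x \<otimes> y) = (\<Sum>k<len x. e x k) \<odot> (\<Sum>l<len y. e y l)"
    using tensor_ident by (simp add: e_def sum_incl_prj)
  also have "\<dots> = (\<Sum>k<len x. e x k \<odot> (\<Sum>l<len y. e y l))"
    by (rule tensor_sum_left) (auto intro: sum_Hom e)
  also have "\<dots> = (\<Sum>k<len x. \<Sum>l<len y. e x k \<odot> e y l)"
    by (intro sum.cong refl tensor_sum_right) (auto intro: e)
  finally have "spread \<nu> (x \<otimes> y) = spread \<nu> (x \<otimes> y) \<cdot> (\<Sum>k<len x. \<Sum>l<len y. e x k \<odot> e y l)"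
    using comp_ident[OF spread_Hom] by metis
  also have "\<dots> = (\<Sum>k<len x. spread \<nu> (x \<otimes> y) \<cdot> (\<Sum>l<len y. e x k \<odot> e y l))"
    by (rule comp_sum_right[OF spread_Hom]) (auto intro!: sum_Hom tensor_Hom e)
  also have "\<dots> = (\<Sum>k<len x. \<Sum>l<len y. spread \<nu> (x \<otimes> y) \<cdot> (e x k \<odot> e y l))"
    by (intro sum.cong refl comp_sum_right[OF spread_Hom]) (auto intro!: tensor_Hom e)
  also have "\<dots> = (\<Sum>k<len x. \<Sum>l<len y. smul C (\<nu> (summand x k)) (e x k) \<odot> smul C (\<nu> (summand y l)) (e y l))"
    by (intro sum.cong refl piece) auto
  also have "\<dots> = (\<Sum>k<len x. smul C (\<nu> (summand x k)) (e x k) \<odot> spread \<nu> y)"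
    unfolding spread_def[of _ y] e_def[symmetric]
    by (intro sum.cong refl tensor_sum_right[symmetric]) (auto intro: smul_Hom e)
  also have "\<dots> = spread \<nu> x \<odot> spread \<nu> y"
    unfolding spread_def[of _ x] e_def[symmetric]
    by (rule tensor_sum_left[OF spread_Hom, symmetric]) (auto intro: smul_Hom e)
  finally show ?thesis .
qed

section \<open>Isomorphism classes and multiplicities\<close>

definition rep :: "'o \<Rightarrow> 'o" where
  "rep s = (SOME t. simple t \<and> isomorphic s t)"

definition irreps :: "'o set" where
  "irreps = rep ` {s. simple s}"

lemma rep:
  assumes "simple s"
  shows "simple (rep s)" "isomorphic s (rep s)"
  using someI[of "\<lambda>t. simple t \<and> isomorphic s t" s] assms isomorphic_refl by (auto simp: rep_def)

text \<open>The predicate under the choice depends on the isomorphism class only, so the chosen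
  objects are literally equal and can index sums.\<close>

lemma rep_cong: "isomorphic s t \<Longrightarrow> rep s = rep t"
  unfolding rep_def by (metis isomorphic_sym isomorphic_trans)

lemma finite_irreps: "finite irreps"
proof -
  obtain S where S: "finite S" "\<And>s. simple s \<Longrightarrow> \<exists>t\<in>S. isomorphic s t"
    using finitely_many_simples by (auto simp: finitely_many_simples_def)
  have "irreps \<subseteq> rep ` S"
    unfolding irreps_def using S(2) rep_cong by blast
  then show ?thesis using S(1) finite_surj by blast
qed

lemma irreps_simple: "j \<in> irreps \<Longrightarrow> simple j"
  and rep_irreps: "j \<in> irreps \<Longrightarrow> rep j = j"
  using rep rep_cong[OF rep(2)] by (auto simp: irreps_def)

lemma rep_in_irreps: "simple s \<Longrightarrow> rep s \<in> irreps"
  by (auto simp: irreps_def)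

definition isotypic :: "'o \<Rightarrow> 'o \<Rightarrow> nat set" where
  "isotypic x j = {k. k < len x \<and> rep (summand x k) = j}"

lemma finite_isotypic: "finite (isotypic x j)"
  by (simp add: isotypic_def)

text \<open>\<open>P\<close> and \<open>I\<close> are dual bases of the hom spaces from
  \<open>x\<close> to \<open>j\<close> and back, since \<open>f \<cdot> I k\<close> and
  \<open>P k \<cdot> g\<close> are endomorphisms of \<open>j\<close>, hence scalars. They arise from
  the projections and inclusions of the summands isomorphic to \<open>j\<close>; by Schur's lemma
  the other summands contribute nothing.\<close>

lemma isotypic_basis:
  assumes "j \<in> irreps"
  obtains P I where
    "\<And>k. k \<in> isotypic x j \<Longrightarrow> P k \<in> Hom C x j"
    "\<And>k. k \<in> isotypic x j \<Longrightarrow> I k \<in> Hom C j x"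
    "\<And>k l. k \<in> isotypic x j \<Longrightarrow> l \<in> isotypic x j \<Longrightarrow> P k \<cdot> I l = (if k = l then \<iota> j else 0)"
    "\<And>f. f \<in> Hom C x j \<Longrightarrow> f = (\<Sum>k\<in>isotypic x j. (f \<cdot> I k) \<cdot> P k)"
    "\<And>g. g \<in> Hom C j x \<Longrightarrow> g = (\<Sum>k\<in>isotypic x j. I k \<cdot> P k \<cdot> g)"
proof -
  let ?K = "isotypic x j"
  have "\<exists>\<alpha> \<beta>. \<alpha> \<in> Hom C (summand x k) j \<and> \<beta> \<in> Hom C j (summand x k) \<and>
      \<beta> \<cdot> \<alpha> = \<iota> (summand x k) \<and> \<alpha> \<cdot> \<beta> = \<iota> j" if "k \<in> ?K" for k
    using that rep(2)[OF simple_summand, of k x] by (auto simp: isotypic_def isomorphic_def iso_def)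
  then obtain \<alpha> \<beta> where ab: "\<And>k. k \<in> ?K \<Longrightarrow> \<alpha> k \<in> Hom C (summand x k) j"
      "\<And>k. k \<in> ?K \<Longrightarrow> \<beta> k \<in> Hom C j (summand x k)"
      "\<And>k. k \<in> ?K \<Longrightarrow> \<beta> k \<cdot> \<alpha> k = \<iota> (summand x k)"
      "\<And>k. k \<in> ?K \<Longrightarrow> \<alpha> k \<cdot> \<beta> k = \<iota> j"
    by metis
  have K: "k < len x" if "k \<in> ?K" for k using that by (simp add: isotypic_def)
  have K': "k \<in> ?K" if "k < len x" "isomorphic (summand x k) j" for k
    using that rep_cong rep_irreps[OF assms] by (simp add: isotypic_def)
  have sub: "?K \<subseteq> {..<len x}" using K by auto
  define P where "P k = \<alpha> k \<cdot> prj x k" for k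
  define I where "I k = incl x k \<cdot> \<beta> k" for k
  have P: "P k \<in> Hom C x j" and I: "I k \<in> Hom C j x" if "k \<in> ?K" for k
    unfolding P_def I_def using comp_Hom[OF prj_Hom ab(1)] comp_Hom[OF ab(2) incl_Hom] that K by auto
  have IP: "I k \<cdot> P k = incl x k \<cdot> prj x k" if k: "k \<in> ?K" for k
  proof -
    note H = incl_Hom[OF K[OF k]] prj_Hom[OF K[OF k]] ab(1,2)[OF k]
    have "I k \<cdot> P k = incl x k \<cdot> (\<beta> k \<cdot> \<alpha> k) \<cdot> prj x k"
      unfolding I_def P_def by (rule comp_regroup[OF H(2,3,4,1)])
    then show ?thesis using ab(3)[OF k] ident_comp[OF H(2)] by simp
  qed
  show ?thesis
  proof (rule that[of P I])
    fix k l assume k: "k \<in> ?K" and l: "l \<in> ?K"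
    note H = incl_Hom[OF K[OF l]] prj_Hom[OF K[OF k]] ab(1)[OF k] ab(2)[OF l]
    have "P k \<cdot> I l = \<alpha> k \<cdot> (prj x k \<cdot> incl x l) \<cdot> \<beta> l"
      unfolding I_def P_def by (rule comp_regroup[OF H(4,1,2,3)])
    then show "P k \<cdot> I l = (if k = l then \<iota> j else 0)"
      using prj_incl[OF K[OF k] K[OF l]] ab(4)[OF k] ident_comp[OF ab(2)[OF k]] comp_zero_left[OF H(4)]
        comp_zero_right[OF H(3)] by auto
  next
    fix f assume f: "f \<in> Hom C x j"
    have "f = (\<Sum>k<len x. (f \<cdot> incl x k) \<cdot> prj x k)" by (rule expand_right[OF f])
    also have "\<dots> = (\<Sum>k\<in>?K. (f \<cdot> incl x k) \<cdot> prj x k)"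
    proof (rule sum.mono_neutral_right[OF _ sub])
      show "\<forall>k\<in>{..<len x} - ?K. (f \<cdot> incl x k) \<cdot> prj x k = 0"
      proof
        fix k assume k: "k \<in> {..<len x} - ?K"
        then have "f \<cdot> incl x k = 0"
          using schur[OF simple_summand irreps_simple[OF assms] comp_Hom[OF incl_Hom f]] K'
          by (auto simp: isomorphic_def)
        then show "(f \<cdot> incl x k) \<cdot> prj x k = 0"
          using comp_zero_left[OF prj_Hom] k by auto
      qed
    qed simp
    also have "\<dots> = (\<Sum>k\<in>?K. (f \<cdot> I k) \<cdot> P k)"
    proof (rule sum.cong)
      fix k assume k: "k \<in> ?K"
      show "(f \<cdot> incl x k) \<cdot> prj x k = (f \<cdot> I k) \<cdot> P k"
        using comp_assoc[OF P[OF k] I[OF k] f] comp_assoc[OF prj_Hom incl_Hom f] IP[OF k] K[OF k] by simp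
    qed simp
    finally show "f = (\<Sum>k\<in>?K. (f \<cdot> I k) \<cdot> P k)" .
  next
    fix g assume g: "g \<in> Hom C j x"
    have "g = (\<Sum>k<len x. incl x k \<cdot> prj x k \<cdot> g)" by (rule expand_left[OF g])
    also have "\<dots> = (\<Sum>k\<in>?K. incl x k \<cdot> prj x k \<cdot> g)"
    proof (rule sum.mono_neutral_right[OF _ sub])
      show "\<forall>k\<in>{..<len x} - ?K. incl x k \<cdot> prj x k \<cdot> g = 0"
      proof
        fix k assume k: "k \<in> {..<len x} - ?K"
        then have "prj x k \<cdot> g = 0"
          using schur[OF irreps_simple[OF assms] simple_summand comp_Hom[OF g prj_Hom]] K'
          by (auto simp: isomorphic_def dest: isomorphic_sym[unfolded isomorphic_def, OF exI])
        then show "incl x k \<cdot> prj x k \<cdot> g = 0"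
          using comp_zero_right[OF incl_Hom] k by auto
      qed
    qed simp
    also have "\<dots> = (\<Sum>k\<in>?K. I k \<cdot> P k \<cdot> g)"
    proof (rule sum.cong)
      fix k assume k: "k \<in> ?K"
      show "incl x k \<cdot> prj x k \<cdot> g = I k \<cdot> P k \<cdot> g"
        using comp_assoc[OF g P[OF k] I[OF k]] comp_assoc[OF g prj_Hom incl_Hom] IP[OF k] K[OF k] by simp
    qed simp
    finally show "g = (\<Sum>k\<in>?K. I k \<cdot> P k \<cdot> g)" .
  qed (use P I in auto)
qed

end

section \<open>The conjugate pivotal structure\<close>

locale pivotal_fusion_category = fusion_category C + pivotal_category C a
  for C :: "('o, 'm::ab_group_add) category_data" (structure) and a :: "'o \<Rightarrow> 'm"
begin

section \<open>Traces and dimensions as complex numbers\<close>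

definition ltr :: "'o \<Rightarrow> 'm \<Rightarrow> complex" where "ltr c f = scalar (mor (Ltr (c, f, c)))"
definition rtr :: "'o \<Rightarrow> 'm \<Rightarrow> complex" where "rtr c f = scalar (mor (Rtr (c, f, c)))"

lemma arr_Ltr: "arr f \<Longrightarrow> src f = trg f \<Longrightarrow> arr (Ltr f)" "src (Ltr f) = \<one>" "trg (Ltr f) = \<one>"
  and arr_Rtr: "arr f \<Longrightarrow> src f = trg f \<Longrightarrow> arr (Rtr f)" "src (Rtr f) = \<one>" "trg (Rtr f) = \<one>"
  by (simp_all add: Ltr_def Rtr_def)

lemma mor_Ltr_Hom: "f \<in> Hom C c c \<Longrightarrow> mor (Ltr (c, f, c)) \<in> Hom C \<one> \<one>"
  and mor_Rtr_Hom: "f \<in> Hom C c c \<Longrightarrow> mor (Rtr (c, f, c)) \<in> Hom C \<one> \<one>"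
  using arr_Ltr[of "(c, f, c)"] arr_Rtr[of "(c, f, c)"] by (simp_all add: arr_def)

lemma ltr_arrow: "src f = c \<Longrightarrow> trg f = c \<Longrightarrow> ltr c (mor f) = scalar (mor (Ltr f))"
  and rtr_arrow: "src f = c \<Longrightarrow> trg f = c \<Longrightarrow> rtr c (mor f) = scalar (mor (Rtr f))"
  by (cases f; simp add: ltr_def rtr_def)+

lemma Ht_Hom: "mor (Ht c) \<in> Hom C \<one> (c\<^sup>\<star> \<otimes> c)"
  and Et_Hom: "mor (Et c) \<in> Hom C (c \<otimes> c\<^sup>\<star>) \<one>"
  and ev_Hom: "ev c \<in> Hom C (c\<^sup>\<star> \<otimes> c) \<one>"
  and coev_Hom: "coev c \<in> Hom C \<one> (c \<otimes> c\<^sup>\<star>)"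
  using mor_Hom[of "Ht c"] mor_Hom[of "Et c"] mor_Hom[of "Ev c"] mor_Hom[of "Co c"] by simp_all

lemma ltr_add:
  assumes "f \<in> Hom C c c" "g \<in> Hom C c c"
  shows "ltr c (f + g) = ltr c f + ltr c g"
proof -
  note T = tensor_Hom[OF ident_Hom[of "c\<^sup>\<star>"] assms(1)] tensor_Hom[OF ident_Hom[of "c\<^sup>\<star>"] assms(2)]
  have "mor (Ltr (c, f + g, c)) = mor (Ltr (c, f, c)) + mor (Ltr (c, g, c))"
    using tensor_add_right[OF ident_Hom[of "c\<^sup>\<star>"] assms] comp_add_left[OF Ht_Hom T]
      comp_add_right[OF comp_Hom[OF Ht_Hom T(1)] comp_Hom[OF Ht_Hom T(2)] ev_Hom]
    by (simp add: Ltr_def)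
  then show ?thesis
    using assms by (simp add: ltr_def scalar_add mor_Ltr_Hom)
qed

lemma ltr_smul:
  assumes "f \<in> Hom C c c"
  shows "ltr c (smul C z f) = z * ltr c f"
proof -
  note T = tensor_Hom[OF ident_Hom[of "c\<^sup>\<star>"] assms(1)]
  have "mor (Ltr (c, smul C z f, c)) = smul C z (mor (Ltr (c, f, c)))"
    using tensor_smul_right[OF ident_Hom[of "c\<^sup>\<star>"] assms] comp_smul_left[OF Ht_Hom T]
      comp_smul_right[OF comp_Hom[OF Ht_Hom T] ev_Hom]
    by (simp add: Ltr_def)
  then show ?thesis
    using assms by (simp add: ltr_def scalar_smul mor_Ltr_Hom)
qed

lemma rtr_smul:
  assumes "f \<in> Hom C c c"
  shows "rtr c (smul C z f) = z * rtr c f"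
proof -
  note T = tensor_Hom[OF assms(1) ident_Hom[of "c\<^sup>\<star>"]]
  have "mor (Rtr (c, smul C z f, c)) = smul C z (mor (Rtr (c, f, c)))"
    using tensor_smul_left[OF assms ident_Hom[of "c\<^sup>\<star>"]] comp_smul_left[OF coev_Hom T]
      comp_smul_right[OF comp_Hom[OF coev_Hom T] Et_Hom]
    by (simp add: Rtr_def)
  then show ?thesis
    using assms by (simp add: rtr_def scalar_smul mor_Rtr_Hom)
qed

lemma ltr_sum:
  assumes "\<And>k. k \<in> A \<Longrightarrow> f k \<in> Hom C c c"
  shows "ltr c (\<Sum>k\<in>A. f k) = (\<Sum>k\<in>A. ltr c (f k))"
  using assms
proof (induction A rule: infinite_finite_induct)
  case (insert k A)
  have "ltr c (f k + sum f A) = ltr c (f k) + ltr c (sum f A)"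
    using insert.prems by (intro ltr_add) (auto intro: sum_Hom)
  then show ?case using insert by simp
qed (use ltr_smul[OF zero_Hom, of c 0] in simp_all)

lemma ltr_cyclic:
  assumes "f \<in> Hom C c d" "g \<in> Hom C d c"
  shows "ltr c (g \<cdot> f) = ltr d (f \<cdot> g)"
  using Ltr_cyclic[of "(c, f, d)" c d "(d, g, c)"] assms by (simp add: ltr_def acomp_def)

lemma rtr_cyclic:
  assumes "f \<in> Hom C c d" "g \<in> Hom C d c"
  shows "rtr c (g \<cdot> f) = rtr d (f \<cdot> g)"
  using Rtr_cyclic[of "(c, f, d)" c d "(d, g, c)"] assms by (simp add: rtr_def acomp_def)

definition ldim :: "'o \<Rightarrow> complex" where "ldim c = ltr c (\<iota> c)"
definition rdim :: "'o \<Rightarrow> complex" where "rdim c = rtr c (\<iota> c)"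

lemma ldim_Ltr: "ldim c = scalar (mor (Ltr (Id c)))"
  and rdim_Rtr: "rdim c = scalar (mor (Rtr (Id c)))"
  by (simp_all add: ldim_def rdim_def ltr_def rtr_def Id_def)

lemma left_dimension_eq_ldim: "left_dimension a c = ldim c"
  unfolding left_dimension_def left_dimension_map_eq ldim_Ltr scalar_def by (simp add: Ltr_def)

lemma ldim_isomorphic:
  assumes "isomorphic c d"
  shows "ldim c = ldim d"
proof -
  obtain f g where "f \<in> Hom C c d" "g \<in> Hom C d c" "g \<cdot> f = \<iota> c" "f \<cdot> g = \<iota> d"
    using assms by (auto simp: isomorphic_def iso_def)
  then show ?thesis
    using ltr_cyclic[of f c d g] by (simp add: ldim_def)
qed

text \<open>Closing the strand \<open>c\<close> of the identity leaves the scalar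
  \<open>ldim c\<close> times the identity of \<open>d\<close>.\<close>

lemma ldim_tensor: "ldim (c \<otimes> d) = ldim c * ldim d"
proof -
  have "ptr_left c d (Id (c \<otimes> d)) = rw (Ltr (Id c)) d"
    by (simp add: ptr_left_def Ltr_def)
  then have "Ltr (Id (c \<otimes> d)) = Ltr (rw (Ltr (Id c)) d)"
    using Ltr_ptr_left[of "Id (c \<otimes> d)" c d] by simp
  then have "ldim (c \<otimes> d) = ltr d (mor (rw (Ltr (Id c)) d))"
    using arr_Ltr[of "Id c"] by (subst ltr_arrow) (simp_all add: ldim_Ltr)
  also have "mor (rw (Ltr (Id c)) d) = smul C (ldim c) (\<iota> \<one>) \<odot> \<iota> d"
    using mor_Ltr_Hom[OF ident_Hom, of c] by (simp add: ldim_def ltr_def Id_def scalar_smul_ident)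
  also have "\<dots> = smul C (ldim c) (\<iota> d)"
    using tensor_smul_left[OF ident_Hom[of \<one>] ident_Hom[of d]] unit_tensor[OF ident_Hom[of d]] by simp
  finally show ?thesis
    by (simp add: ltr_smul ident_Hom flip: ldim_def)
qed

text \<open>By \<open>Ht_dual\<close>, a left loop on the dual of \<open>c\<close> is a right loop
  on \<open>c\<close>.\<close>

lemma ldim_dual: "ldim (c\<^sup>\<star>) = rdim c"
  unfolding ldim_Ltr rdim_Rtr by (simp add: Ltr_def Rtr_def Ht_dual Et_def)

text \<open>
  The evaluation \<open>s\<^sup>\<star> \<otimes> s \<rightarrow> \<one>\<close> is nonzero and hence has a section by semisimplicity. By adjunction
  and Schur's lemma, this section is a multiple of the coevaluation \<open>Ht s\<close>.
\<close>

lemma ldim_nonzero: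
  assumes "simple s"
  shows "ldim s \<noteq> 0"
proof -
  let ?y = "s\<^sup>\<star> \<otimes> s"
  have "ev s \<noteq> 0"
  proof
    assume "ev s = 0"
    moreover have "(\<iota> s \<odot> ev s) \<cdot> (coev s \<odot> \<iota> s) = \<iota> s"
      using arg_cong[OF adjD(7)[OF adj_Ev_Co], of mor s] by simp
    moreover have "\<iota> s \<odot> 0 = 0"
      using tensor_add_right[OF ident_Hom[of s] zero_Hom[of \<one> \<one>] zero_Hom] by simp
    ultimately show False
      using comp_zero_left[OF tensor_Hom[OF coev_Hom[of s] ident_Hom[of s]]] simple_ident_nonzero[OF assms]
      by simp
  qed
  moreover have "ev s = (\<Sum>k<len ?y. (ev s \<cdot> incl ?y k) \<cdot> prj ?y k)"
    by (rule expand_right[OF ev_Hom])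
  ultimately obtain k where k: "k < len ?y" "(ev s \<cdot> incl ?y k) \<cdot> prj ?y k \<noteq> 0"
    by (metis (no_types, lifting) lessThan_iff sum.neutral)
  then have "ev s \<cdot> incl ?y k \<noteq> 0"
    using comp_zero_left[OF prj_Hom] by metis
  then have "iso (summand ?y k) \<one> (ev s \<cdot> incl ?y k)"
    using schur[OF simple_summand simple_unit comp_Hom[OF incl_Hom ev_Hom]] k(1) by blast
  then obtain g where g: "g \<in> Hom C \<one> (summand ?y k)" "(ev s \<cdot> incl ?y k) \<cdot> g = \<iota> \<one>"
    by (auto simp: iso_def)
  define t where "t = (\<one>, incl ?y k \<cdot> g, ?y)"
  have t: "arr t" "src t = \<one>" "trg t = ?y"
    using comp_Hom[OF g(1) incl_Hom[OF k(1)]] by (simp_all add: t_def)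
  define u where "u = rw (Et s) s \<bullet> lw s t"
  have u: "arr u" "src u = s" "trg u = s"
    using t by (simp_all add: u_def)
  have "lw (s\<^sup>\<star>) u \<bullet> Ht s = t"
    using adjunct_of_inverse[OF adj_Et_Ht t] by (simp add: u_def)
  then have "mor (Ltr u) = \<iota> \<one>"
    using g(2) comp_assoc[OF g(1) incl_Hom[OF k(1)] ev_Hom] by (simp add: Ltr_def u t_def)
  then have "ltr s (mor u) = 1"
    using u by (simp add: ltr_arrow scalar_eqI)
  moreover obtain z where "mor u = smul C z (\<iota> s)"
    using End_simple_scalar[OF assms mor_Hom[OF u]] by blast
  ultimately show ?thesis
    using ltr_smul[OF ident_Hom, of s z] by (auto simp: ldim_def)
qed

lemma ltr_incl_prj: "k < len x \<Longrightarrow> ltr x (incl x k \<cdot> prj x k) = ldim (summand x k)"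
  using ltr_cyclic[OF incl_Hom[of k x] prj_Hom[of k x]] prj_incl[of k x k] by (simp add: ldim_def)

lemma ltr_spread: "ltr x (spread \<nu> x) = (\<Sum>k<len x. \<nu> (summand x k) * ldim (summand x k))"
  unfolding spread_def
  by (subst ltr_sum) (auto intro!: sum.cong smul_Hom comp_Hom[OF prj_Hom incl_Hom]
      simp: ltr_smul[OF comp_Hom[OF prj_Hom incl_Hom]] ltr_incl_prj)

lemma ldim_summands: "ldim x = (\<Sum>k<len x. ldim (summand x k))"
proof -
  have "spread (\<lambda>_. 1) x = \<iota> x" by (simp add: spread_def sum_incl_prj)
  then show ?thesis using ltr_spread[of x "\<lambda>_. 1"] by (simp add: ldim_def)
qed

lemma ldim_isotypic: "ldim x = (\<Sum>j\<in>irreps. of_nat (card (isotypic x j)) * ldim j)"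
proof -
  have "ldim x = (\<Sum>k<len x. ldim (rep (summand x k)))"
    unfolding ldim_summands[of x]
    by (intro sum.cong refl ldim_isomorphic rep(2) simple_summand) auto
  also have "\<dots> = (\<Sum>j\<in>irreps. \<Sum>k\<in>{k\<in>{..<len x}. rep (summand x k) = j}. ldim (rep (summand x k)))"
    by (rule sum.group[symmetric]) (auto simp: finite_irreps intro: rep_in_irreps simple_summand)
  also have "\<dots> = (\<Sum>j\<in>irreps. \<Sum>k\<in>isotypic x j. ldim j)"
    by (intro sum.cong) (auto simp: isotypic_def)
  finally show ?thesis by simp
qed

section \<open>Symmetry of fusion multiplicities and conjugate dimensions\<close>

lemma tensor_sum_smul_right:
  assumes "\<And>k. k \<in> A \<Longrightarrow> f k \<in> Hom C x y"
  shows "\<iota> v \<odot> (\<Sum>k\<in>A. smul C (z k) (f k)) = (\<Sum>k\<in>A. smul C (z k) (\<iota> v \<odot> f k))"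
proof -
  have "\<iota> v \<odot> (\<Sum>k\<in>A. smul C (z k) (f k)) = (\<Sum>k\<in>A. \<iota> v \<odot> smul C (z k) (f k))"
    by (rule tensor_sum_right[OF ident_Hom]) (auto intro: smul_Hom assms)
  also have "\<dots> = (\<Sum>k\<in>A. smul C (z k) (\<iota> v \<odot> f k))"
    by (intro sum.cong refl tensor_smul_right[OF ident_Hom]) (auto intro: assms)
  finally show ?thesis .
qed

lemma comp_tensor_sum_smul:
  assumes "\<And>k. k \<in> A \<Longrightarrow> f k \<in> Hom C x y" "g \<in> Hom C (v \<otimes> y) w"
  shows "g \<cdot> (\<iota> v \<odot> (\<Sum>k\<in>A. smul C (z k) (f k))) = (\<Sum>k\<in>A. smul C (z k) (g \<cdot> (\<iota> v \<odot> f k)))"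
proof -
  note T = tensor_Hom[OF ident_Hom[of v] assms(1)]
  have "g \<cdot> (\<Sum>k\<in>A. smul C (z k) (\<iota> v \<odot> f k)) = (\<Sum>k\<in>A. g \<cdot> smul C (z k) (\<iota> v \<odot> f k))"
    by (rule comp_sum_right[OF assms(2)]) (auto intro: smul_Hom T)
  also have "\<dots> = (\<Sum>k\<in>A. smul C (z k) (g \<cdot> (\<iota> v \<odot> f k)))"
    by (intro sum.cong refl comp_smul_right[OF _ assms(2)]) (auto intro: T)
  finally show ?thesis
    using tensor_sum_smul_right[where f = f, OF assms(1)] by simp
qed

lemma tensor_sum_smul_comp:
  assumes "\<And>k. k \<in> A \<Longrightarrow> f k \<in> Hom C x y" "h \<in> Hom C u (v \<otimes> x)"
  shows "(\<iota> v \<odot> (\<Sum>k\<in>A. smul C (z k) (f k))) \<cdot> h = (\<Sum>k\<in>A. smul C (z k) ((\<iota> v \<odot> f k) \<cdot> h))"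
proof -
  note T = tensor_Hom[OF ident_Hom[of v] assms(1)]
  have "(\<Sum>k\<in>A. smul C (z k) (\<iota> v \<odot> f k)) \<cdot> h = (\<Sum>k\<in>A. smul C (z k) (\<iota> v \<odot> f k) \<cdot> h)"
    by (rule comp_sum_left[OF assms(2)]) (auto intro: smul_Hom T)
  also have "\<dots> = (\<Sum>k\<in>A. smul C (z k) ((\<iota> v \<odot> f k) \<cdot> h))"
    by (intro sum.cong refl comp_smul_left[OF assms(2)]) (auto intro: T)
  finally show ?thesis
    using tensor_sum_smul_right[where f = f, OF assms(1)] by simp
qed

text \<open>Both numbers are the dimension of one space: the duality \<open>Et\<close>,
  \<open>Ht\<close> identifies arrows \<open>x \<otimes> i -> j\<close> with arrows
  \<open>i -> x\<^sup>\<star> \<otimes> j\<close>. The linear maps \<Phi> and \<Psi> are the two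
  directions.\<close>

lemma card_isotypic_adjoint:
  assumes i: "i \<in> irreps" and j: "j \<in> irreps"
  shows "card (isotypic (x \<otimes> i) j) = card (isotypic (x\<^sup>\<star> \<otimes> j) i)"
proof -
  let ?y = "x \<otimes> i" and ?z = "x\<^sup>\<star> \<otimes> j"
  let ?K = "isotypic ?y j" and ?L = "isotypic ?z i"
  obtain P I where P: "\<And>k. k \<in> ?K \<Longrightarrow> P k \<in> Hom C ?y j"
    and I: "\<And>k. k \<in> ?K \<Longrightarrow> I k \<in> Hom C j ?y"
    and PI: "\<And>k l. k \<in> ?K \<Longrightarrow> l \<in> ?K \<Longrightarrow> P k \<cdot> I l = (if k = l then \<iota> j else 0)"
    and P_span: "\<And>f. f \<in> Hom C ?y j \<Longrightarrow> f = (\<Sum>k\<in>?K. (f \<cdot> I k) \<cdot> P k)"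
    by (rule isotypic_basis[OF j, of ?y]) blast
  obtain Q J where Q: "\<And>k. k \<in> ?L \<Longrightarrow> Q k \<in> Hom C ?z i"
    and J: "\<And>k. k \<in> ?L \<Longrightarrow> J k \<in> Hom C i ?z"
    and QJ: "\<And>k l. k \<in> ?L \<Longrightarrow> l \<in> ?L \<Longrightarrow> Q k \<cdot> J l = (if k = l then \<iota> i else 0)"
    and J_span: "\<And>g. g \<in> Hom C i ?z \<Longrightarrow> g = (\<Sum>k\<in>?L. J k \<cdot> Q k \<cdot> g)"
    by (rule isotypic_basis[OF i, of ?z]) blast
  define \<Phi> where "\<Phi> f = (\<iota> (x\<^sup>\<star>) \<odot> f) \<cdot> (mor (Ht x) \<odot> \<iota> i)" for f
  define \<Psi> where "\<Psi> g = (mor (Et x) \<odot> \<iota> j) \<cdot> (\<iota> x \<odot> g)" for g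
  have h: "mor (Ht x) \<odot> \<iota> i \<in> Hom C i (x\<^sup>\<star> \<otimes> ?y)" and e: "mor (Et x) \<odot> \<iota> j \<in> Hom C (x \<otimes> ?z) j"
    using tensor_Hom[OF Ht_Hom ident_Hom, of x i] tensor_Hom[OF Et_Hom ident_Hom, of x j] by simp_all
  have \<Phi>: "\<Phi> f \<in> Hom C i ?z" and \<Psi>\<Phi>: "\<Psi> (\<Phi> f) = f" if f: "f \<in> Hom C ?y j" for f
  proof -
    show "\<Phi> f \<in> Hom C i ?z"
      unfolding \<Phi>_def by (rule comp_Hom[OF h tensor_Hom[OF ident_Hom f]])
    show "\<Psi> (\<Phi> f) = f"
      using arg_cong[OF adjunct_inverse[OF adj_Et_Ht, of "(?y, f, j)" x i j], of mor]
        interchange[OF ident_Hom[of x] ident_Hom[of x] h tensor_Hom[OF ident_Hom f]] f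
      by (simp add: \<Phi>_def \<Psi>_def del: lw_acomp)
  qed
  have \<Psi>: "\<Psi> g \<in> Hom C ?y j" and \<Phi>\<Psi>: "\<Phi> (\<Psi> g) = g" if g: "g \<in> Hom C i ?z" for g
  proof -
    show "\<Psi> g \<in> Hom C ?y j"
      unfolding \<Psi>_def by (rule comp_Hom[OF tensor_Hom[OF ident_Hom g] e])
    show "\<Phi> (\<Psi> g) = g"
      using arg_cong[OF adjunct_of_inverse[OF adj_Et_Ht, of "(i, g, ?z)" i x j], of mor] g
      by (simp add: \<Phi>_def \<Psi>_def del: lw_acomp)
  qed
  have \<Phi>_sum: "\<Phi> (\<Sum>k\<in>?K. smul C (z k) (P k)) = (\<Sum>k\<in>?K. smul C (z k) (\<Phi> (P k)))" for z
    unfolding \<Phi>_def by (rule tensor_sum_smul_comp[OF P h])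
  have \<Psi>_sum: "\<Psi> (\<Sum>k\<in>?L. smul C (z k) (J k)) = (\<Sum>k\<in>?L. smul C (z k) (\<Psi> (J k)))" for z
    unfolding \<Psi>_def by (rule comp_tensor_sum_smul[OF J e])
  \<comment> \<open>If \<open>J\<close> were the shorter family, the images
    \<open>\<Phi> (P k)\<close> in its span would satisfy a linear relation. \<Psi> carries it back
    to the \<open>P k\<close>, and composing with the \<open>I l\<close> shows that it is
    trivial.\<close>
  have "\<not> card ?L < card ?K"
  proof
    assume less: "card ?L < card ?K"
    have "\<Phi> (P k) \<in> vs.span (J ` ?L)" if k: "k \<in> ?K" for k
    proof -
      have "J l \<cdot> Q l \<cdot> \<Phi> (P k) \<in> vs.span (J ` ?L)" if l: "l \<in> ?L" for l
      proof -
        obtain z where "Q l \<cdot> \<Phi> (P k) = smul C z (\<iota> i)"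
          using End_simple_scalar[OF irreps_simple[OF i] comp_Hom[OF \<Phi>[OF P[OF k]] Q[OF l]]] by blast
        then have "J l \<cdot> Q l \<cdot> \<Phi> (P k) = smul C z (J l)"
          using comp_smul_right[OF ident_Hom J[OF l]] comp_ident[OF J[OF l]] by simp
        then show ?thesis using l by (auto intro: vs.span_scale vs.span_base)
      qed
      then show ?thesis
        by (subst J_span[OF \<Phi>[OF P[OF k]]]) (rule vs.span_sum)
    qed
    moreover have "card (J ` ?L) < card ?K"
      using less card_image_le[OF finite_isotypic[of ?z i], of J] by simp
    ultimately obtain z where z: "\<exists>k\<in>?K. z k \<noteq> 0" "(\<Sum>k\<in>?K. smul C (z k) (\<Phi> (P k))) = 0"
      using vs.exists_linear_relation[of ?K "J ` ?L" "\<lambda>k. \<Phi> (P k)"] finite_isotypic by blast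
    have 0: "(\<Sum>k\<in>?K. smul C (z k) (P k)) = 0" (is "?s = 0")
    proof -
      have s: "?s \<in> Hom C ?y j" by (intro sum_Hom smul_Hom P)
      \<comment> \<open>Zero coefficients in \<open>\<Phi>_sum\<close> give
        \<open>\<Phi> 0 = 0\<close>.\<close>
      have "\<Phi> ?s = \<Phi> 0"
        using z(2) \<Phi>_sum \<Phi>_sum[of "\<lambda>_. 0"] by simp
      then show ?thesis
        using \<Psi>\<Phi>[OF s] \<Psi>\<Phi>[OF zero_Hom] by simp
    qed
    have "z l = 0" if l: "l \<in> ?K" for l
    proof -
      have "0 = (\<Sum>k\<in>?K. smul C (z k) (P k)) \<cdot> I l"
        unfolding 0 using comp_zero_left[OF I[OF l]] by simp
      also have "\<dots> = (\<Sum>k\<in>?K. smul C (z k) (P k) \<cdot> I l)"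
        by (rule comp_sum_left[OF I[OF l]]) (auto intro: smul_Hom P)
      also have "\<dots> = (\<Sum>k\<in>?K. if k = l then smul C (z l) (\<iota> j) else 0)"
        using comp_smul_left[OF I[OF l] P] PI[OF _ l] by (intro sum.cong) auto
      also have "\<dots> = smul C (z l) (\<iota> j)"
        using l finite_isotypic by simp
      finally show ?thesis
        using simple_ident_nonzero[OF irreps_simple[OF j]] by simp
    qed
    then show False using z(1) by blast
  qed
  moreover have "\<not> card ?K < card ?L"
  proof
    assume less: "card ?K < card ?L"
    have "\<Psi> (J k) \<in> vs.span (P ` ?K)" if k: "k \<in> ?L" for k
    proof -
      have "(\<Psi> (J k) \<cdot> I l) \<cdot> P l \<in> vs.span (P ` ?K)" if l: "l \<in> ?K" for l
      proof -
        obtain z where "\<Psi> (J k) \<cdot> I l = smul C z (\<iota> j)"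
          using End_simple_scalar[OF irreps_simple[OF j] comp_Hom[OF I[OF l] \<Psi>[OF J[OF k]]]] by blast
        then have "(\<Psi> (J k) \<cdot> I l) \<cdot> P l = smul C z (P l)"
          using comp_smul_left[OF P[OF l] ident_Hom] ident_comp[OF P[OF l]] by simp
        then show ?thesis using l by (auto intro: vs.span_scale vs.span_base)
      qed
      then show ?thesis
        by (subst P_span[OF \<Psi>[OF J[OF k]]]) (rule vs.span_sum)
    qed
    moreover have "card (P ` ?K) < card ?L"
      using less card_image_le[OF finite_isotypic[of ?y j], of P] by simp
    ultimately obtain z where z: "\<exists>k\<in>?L. z k \<noteq> 0" "(\<Sum>k\<in>?L. smul C (z k) (\<Psi> (J k))) = 0"
      using vs.exists_linear_relation[of ?L "P ` ?K" "\<lambda>k. \<Psi> (J k)"] finite_isotypic by blast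
    have 0: "(\<Sum>k\<in>?L. smul C (z k) (J k)) = 0" (is "?s = 0")
    proof -
      have s: "?s \<in> Hom C i ?z" by (intro sum_Hom smul_Hom J)
      have "\<Psi> ?s = \<Psi> 0"
        using z(2) \<Psi>_sum \<Psi>_sum[of "\<lambda>_. 0"] by simp
      then show ?thesis
        using \<Phi>\<Psi>[OF s] \<Phi>\<Psi>[OF zero_Hom] by simp
    qed
    have "z l = 0" if l: "l \<in> ?L" for l
    proof -
      have "0 = Q l \<cdot> (\<Sum>k\<in>?L. smul C (z k) (J k))"
        unfolding 0 using comp_zero_right[OF Q[OF l]] by simp
      also have "\<dots> = (\<Sum>k\<in>?L. Q l \<cdot> smul C (z k) (J k))"
        by (rule comp_sum_right[OF Q[OF l]]) (auto intro: smul_Hom J)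
      also have "\<dots> = (\<Sum>k\<in>?L. if k = l then smul C (z l) (\<iota> i) else 0)"
        using comp_smul_right[OF J Q[OF l]] QJ[OF l] by (intro sum.cong) auto
      also have "\<dots> = smul C (z l) (\<iota> i)"
        using l finite_isotypic by simp
      finally show ?thesis
        using simple_ident_nonzero[OF irreps_simple[OF i]] by simp
    qed
    then show False using z(1) by blast
  qed
  ultimately show ?thesis by simp
qed

text \<open>The dimension vector is an eigenvector of the fusion matrix of \<open>x\<close> and of
  its transpose, by facts \<open>1\<close> and \<open>2\<close>. Moving the matrix across the
  Hermitian form compares the two eigenvalues; \<open>S\<close> is the squared norm of the
  vector.\<close>

lemma rdim_cnj: "rdim x = cnj (ldim x)"
proof -
  define m where "m i j = complex_of_nat (card (isotypic (x \<otimes> i) j))" for i j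
  define S where "S = (\<Sum>i\<in>irreps. cnj (ldim i) * ldim i)"
  have 1: "ldim x * ldim i = (\<Sum>j\<in>irreps. m i j * ldim j)" for i
    using ldim_isotypic[of "x \<otimes> i"] by (simp add: ldim_tensor m_def)
  have 2: "rdim x * ldim j = (\<Sum>i\<in>irreps. m i j * ldim i)" if "j \<in> irreps" for j
    using ldim_isotypic[of "x\<^sup>\<star> \<otimes> j"] card_isotypic_adjoint[OF _ that]
    by (simp add: ldim_tensor ldim_dual m_def)
  have "cnj (rdim x) * S = (\<Sum>j\<in>irreps. cnj (rdim x * ldim j) * ldim j)"
    by (simp add: S_def sum_distrib_left mult.assoc)
  also have "\<dots> = (\<Sum>j\<in>irreps. \<Sum>i\<in>irreps. m i j * cnj (ldim i) * ldim j)"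
    by (intro sum.cong refl) (simp add: 2 sum_distrib_right m_def)
  also have "\<dots> = (\<Sum>i\<in>irreps. \<Sum>j\<in>irreps. m i j * cnj (ldim i) * ldim j)"
    by (rule sum.swap)
  also have "\<dots> = (\<Sum>i\<in>irreps. cnj (ldim i) * (ldim x * ldim i))"
    by (intro sum.cong refl, simp only: 1, simp add: sum_distrib_left mult_ac)
  also have "\<dots> = ldim x * S"
    by (simp add: S_def sum_distrib_left mult_ac)
  finally have "cnj (rdim x) * S = ldim x * S" .
  moreover have "S \<noteq> 0"
  proof -
    have "S = of_real (\<Sum>i\<in>irreps. (cmod (ldim i))\<^sup>2)"
      by (simp add: S_def complex_norm_square mult.commute del: of_real_power)
    \<comment> \<open>The sum has positive terms, and it is not empty because the unit has a
      representative.\<close>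
    moreover have "(\<Sum>i\<in>irreps. (cmod (ldim i))\<^sup>2) > 0"
      using ldim_nonzero[OF irreps_simple] rep_in_irreps[OF simple_unit] finite_irreps
      by (intro sum_pos) auto
    ultimately show ?thesis by (metis less_irrefl of_real_eq_0_iff)
  qed
  ultimately have "cnj (rdim x) = ldim x" by simp
  then show ?thesis by (metis complex_cnj_cnj)
qed

section \<open>Comparison of left and right traces\<close>

definition ratio :: "'o \<Rightarrow> complex" where "ratio s = rdim s / ldim s"

lemma ratio_nonzero: "simple s \<Longrightarrow> ratio s \<noteq> 0"
  using ldim_nonzero by (simp add: ratio_def rdim_cnj)

lemma ratio_isomorphic: "isomorphic s t \<Longrightarrow> ratio s = ratio t"
  using ldim_isomorphic by (simp add: ratio_def rdim_cnj)

text \<open>Both traces are linear on a one-dimensional space, so the factor is read off at the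
  identity. It is 1 exactly when the two dimensions of \<open>s\<close> agree, and by
  \<open>rdim_cnj\<close> it always has modulus 1.\<close>

lemma rtr_simple:
  assumes "simple s" "f \<in> Hom C s s"
  shows "rtr s f = ratio s * ltr s f"
proof -
  obtain z where "f = smul C z (\<iota> s)"
    using End_simple_scalar[OF assms] by blast
  then show ?thesis
    using ltr_smul[OF ident_Hom, of s z] rtr_smul[OF ident_Hom, of s z] ldim_nonzero[OF assms(1)]
    by (simp add: ratio_def ldim_def rdim_def)
qed

text \<open>Each partial trace is an endomorphism of a simple object, where
  \<open>rtr_simple\<close> applies. Turning the loop of \<open>s\<close> to the left costs
  \<open>ratio s\<close>, then turning that of \<open>t\<close> costs
  \<open>ratio t\<close>.\<close>

lemma rtr_tensor_simple:
  assumes "simple s" "simple t" "f \<in> Hom C (s \<otimes> t) (s \<otimes> t)"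
  shows "rtr (s \<otimes> t) f = ratio s * ratio t * ltr (s \<otimes> t) f"
proof -
  define h where "h = (s \<otimes> t, f, s \<otimes> t)"
  have h: "arr h" "src h = s \<otimes> t" "trg h = s \<otimes> t"
    using assms(3) by (simp_all add: h_def)
  let ?u = "mor (ptr_right s t h)" and ?v = "mor (ptr_left s t h)"
  have u: "?u \<in> Hom C s s" and v: "?v \<in> Hom C t t"
    using ptr_simps[OF h] by (auto intro: mor_Hom)
  have "rtr (s \<otimes> t) f = rtr s ?u"
    using Rtr_ptr_right[OF h] ptr_simps[OF h] by (subst rtr_arrow) (simp_all add: rtr_def h_def)
  also have "\<dots> = ratio s * ltr s ?u"
    by (rule rtr_simple[OF assms(1) u])
  also have "ltr s ?u = rtr t ?v"
    using Ltr_ptr_right[OF h] ptr_simps[OF h] by (simp add: ltr_arrow rtr_arrow)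
  also have "\<dots> = ratio t * ltr t ?v"
    by (rule rtr_simple[OF assms(2) v])
  also have "ltr t ?v = ltr (s \<otimes> t) f"
    using Ltr_ptr_left[OF h] ptr_simps[OF h] by (subst ltr_arrow) (simp_all add: ltr_def h_def)
  finally show ?thesis by simp
qed

text \<open>The comparison is evaluated at the idempotent \<open>i \<cdot> p\<close>, whose two
  traces are the dimensions of \<open>u\<close> by cyclicity.\<close>

lemma ratio_mult:
  assumes "simple s" "simple t" "simple u" "i \<in> Hom C u (s \<otimes> t)" "p \<in> Hom C (s \<otimes> t) u" "p \<cdot> i = \<iota> u"
  shows "ratio u = ratio s * ratio t"
proof -
  have "rdim u = rtr (s \<otimes> t) (i \<cdot> p)"
    using rtr_cyclic[OF assms(4,5)] assms(6) by (simp add: rdim_def)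
  also have "\<dots> = ratio s * ratio t * ldim u"
    using rtr_tensor_simple[OF assms(1,2) comp_Hom[OF assms(5,4)]] ltr_cyclic[OF assms(4,5)] assms(6)
    by (simp add: ldim_def)
  finally show ?thesis
    using ldim_nonzero[OF assms(3)] by (simp add: ratio_def)
qed

text \<open>The unit is a summand of its own square, so its ratio is a nonzero number equal to its
  square.\<close>

lemma ratio_unit: "ratio \<one> = 1"
  using ratio_mult[OF simple_unit simple_unit simple_unit, of "\<iota> \<one>" "\<iota> \<one>"] ratio_nonzero[OF simple_unit]
  by (simp add: ident_Hom comp_ident[OF ident_Hom])

section \<open>The conjugate structure and its dimensions\<close>

definition conjugate :: "'o \<Rightarrow> 'm" where
  "conjugate c = a c \<cdot> spread (\<lambda>s. 1 / ratio s) c"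

lemma spread_ratio:
  shows "spread (\<lambda>s. 1 / ratio s) c \<cdot> spread ratio c = \<iota> c"
    and "spread ratio c \<cdot> spread (\<lambda>s. 1 / ratio s) c = \<iota> c"
  by (rule spread_inverse; use ratio_isomorphic ratio_nonzero in auto)+

lemma pivotal_conjugate: "pivotal_structure conjugate"
  unfolding pivotal_structure_def
proof (intro conjI allI ballI)
  let ?\<theta> = "spread (\<lambda>s. 1 / ratio s)"
  have a: "a c \<in> Hom C c (c\<^sup>\<star>\<^sup>\<star>)" for c
    using iso_a by (rule iso_Hom)
  show "iso c (c\<^sup>\<star>\<^sup>\<star>) (conjugate c)" for c
  proof -
    obtain g where g: "g \<in> Hom C (c\<^sup>\<star>\<^sup>\<star>) c" "g \<cdot> a c = \<iota> c" "a c \<cdot> g = \<iota> (c\<^sup>\<star>\<^sup>\<star>)"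
      using iso_a by (auto simp: iso_def)
    have "(spread ratio c \<cdot> g) \<cdot> conjugate c = \<iota> c"
      unfolding conjugate_def
      using comp_regroup[OF spread_Hom a g(1) spread_Hom] g(2) spread_ratio(2) ident_comp[OF spread_Hom]
      by simp
    moreover have "conjugate c \<cdot> spread ratio c \<cdot> g = \<iota> (c\<^sup>\<star>\<^sup>\<star>)"
      unfolding conjugate_def
      using comp_regroup[OF g(1) spread_Hom spread_Hom a] g(3) spread_ratio(1) ident_comp[OF g(1)]
      by simp
    ultimately show ?thesis
      unfolding iso_def conjugate_def using comp_Hom[OF spread_Hom a] comp_Hom[OF g(1) spread_Hom] by blast
  qed
  show "conjugate d \<cdot> f = double_dual_map c d f \<cdot> conjugate c" if f: "f \<in> Hom C c d" for c d f
  proof -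
    have F: "double_dual_map c d f \<in> Hom C (c\<^sup>\<star>\<^sup>\<star>) (d\<^sup>\<star>\<^sup>\<star>)"
      using mor_Hom[of "dual_arr (dual_arr (c, f, d))"] f
      by (simp add: mor_dual_arr double_dual_map_def)
    have nat: "a d \<cdot> f = double_dual_map c d f \<cdot> a c"
      using pivotal f by (simp add: pivotal_structure_def)
    have "conjugate d \<cdot> f = a d \<cdot> ?\<theta> d \<cdot> f"
      unfolding conjugate_def by (rule comp_assoc[OF f spread_Hom a])
    also have "?\<theta> d \<cdot> f = f \<cdot> ?\<theta> c"
      by (rule spread_natural[OF _ f]) (simp add: ratio_isomorphic)
    also have "a d \<cdot> f \<cdot> ?\<theta> c = (a d \<cdot> f) \<cdot> ?\<theta> c"
      by (rule comp_assoc[OF spread_Hom f a, symmetric])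
    also have "\<dots> = double_dual_map c d f \<cdot> conjugate c"
      unfolding nat conjugate_def by (rule comp_assoc[OF spread_Hom a F])
    finally show ?thesis .
  qed
  show "conjugate (c \<otimes> d) = double_dual_tensor c d \<cdot> (conjugate c \<odot> conjugate d)" for c d
  proof -
    have D: "double_dual_tensor c d \<in> Hom C (c\<^sup>\<star>\<^sup>\<star> \<otimes> d\<^sup>\<star>\<^sup>\<star>) ((c \<otimes> d)\<^sup>\<star>\<^sup>\<star>)"
      using mor_Hom[of "dual_arr (Dti c d) \<bullet> Dt (d\<^sup>\<star>) (c\<^sup>\<star>)"]
      by (simp add: mor_dual_arr mor_Dt mor_Dti double_dual_tensor_def)
    have "?\<theta> (c \<otimes> d) = ?\<theta> c \<odot> ?\<theta> d"
    proof (rule spread_tensor)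
      show "1 / ratio s = 1 / ratio t" if "isomorphic s t" for s t
        using ratio_isomorphic[OF that] by simp
      show "1 / ratio u = 1 / ratio s * (1 / ratio t)" if "simple s" "simple t" "simple u"
        "i \<in> Hom C u (s \<otimes> t)" "p \<in> Hom C (s \<otimes> t) u" "p \<cdot> i = \<iota> u" for s t u i p
        using ratio_mult[OF that] by simp
    qed
    then have "conjugate (c \<otimes> d) = (double_dual_tensor c d \<cdot> (a c \<odot> a d)) \<cdot> (?\<theta> c \<odot> ?\<theta> d)"
      using pivotal by (simp add: conjugate_def pivotal_structure_def)
    also have "\<dots> = double_dual_tensor c d \<cdot> (a c \<odot> a d) \<cdot> (?\<theta> c \<odot> ?\<theta> d)"
      by (rule comp_assoc[OF tensor_Hom[OF spread_Hom spread_Hom] tensor_Hom[OF a a] D])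
    also have "(a c \<odot> a d) \<cdot> (?\<theta> c \<odot> ?\<theta> d) = conjugate c \<odot> conjugate d"
      unfolding conjugate_def by (rule interchange[OF spread_Hom a spread_Hom a, symmetric])
    finally show ?thesis .
  qed
  have "?\<theta> \<one> = \<iota> \<one>"
    by (subst spread_simple) (simp_all add: ratio_isomorphic simple_unit ratio_unit)
  then show "conjugate \<one> = double_dual_unit"
    using pivotal comp_ident[OF a[of \<one>]] by (simp add: conjugate_def pivotal_structure_def)
qed

text \<open>The modification enters the left dimension only through the inverse pivotal isomorphism
  in \<open>Ht\<close>, which turns \<open>1 / ratio\<close> into \<open>ratio\<close>. The new left
  dimension is thus the old left trace of \<open>spread ratio c\<close>, to which a simple summand
  \<open>s\<close> contributes \<open>ratio s * ldim s = rdim s\<close>.\<close>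

lemma left_dimension_conjugate: "left_dimension conjugate c = cnj (left_dimension a c)"
proof -
  interpret B: pivotal_category C conjugate
    by unfold_locales (rule pivotal_conjugate)
  define t where "t = (c, spread ratio c, c)"
  define t' where "t' = (c, spread (\<lambda>s. 1 / ratio s) c, c)"
  have [simp]: "arr t" "src t = c" "trg t = c" "arr t'" "src t' = c" "trg t' = c"
    by (simp_all add: t_def t'_def spread_Hom)
  have tt': "t' \<bullet> t = Id c"
    by (rule arrow_eqI) (simp_all add: t_def t'_def spread_ratio)
  have B: "B.Piv c = Piv c \<bullet> t'"
    by (rule arrow_eqI) (simp_all add: B.Piv_def conjugate_def t'_def)
  \<comment> \<open>\<open>t \<bullet> Pinv c\<close> is a right inverse of \<open>B.Piv c\<close>,
    so the left inverse \<open>B.Pinv c\<close> coincides with it.\<close>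
  have "B.Pinv c = B.Pinv c \<bullet> Piv c \<bullet> (t' \<bullet> t) \<bullet> Pinv c"
    unfolding tt' by (simp add: Piv_Pinv)
  also have "\<dots> = (B.Pinv c \<bullet> B.Piv c) \<bullet> t \<bullet> Pinv c"
    unfolding B by simp
  also have "\<dots> = t \<bullet> Pinv c"
    unfolding B.Pinv_Piv by simp
  finally have "Ev c \<bullet> B.Ht c = Ltr t"
    by (simp add: B.Ht_def Ltr_def Ht_def)
  then have "left_dimension conjugate c = ltr c (spread ratio c)"
    unfolding left_dimension_def B.left_dimension_map_eq by (simp add: ltr_def scalar_def t_def)
  also have "\<dots> = (\<Sum>k<len c. cnj (ldim (summand c k)))"
    unfolding ltr_spread using ldim_nonzero[OF simple_summand]
    by (intro sum.cong) (auto simp: ratio_def rdim_cnj)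
  also have "\<dots> = cnj (left_dimension a c)"
    unfolding left_dimension_eq_ldim by (subst ldim_summands) simp
  finally show ?thesis .
qed

end

theorem mainTheorem2:
  fixes C :: "('o, 'm::ab_group_add) category_data" and a :: "'o \<Rightarrow> 'm"
  assumes "fusion_category C"
    and "rigid_category.pivotal_structure C a"
  shows "\<exists>b. rigid_category.pivotal_structure C b \<and>
           (\<forall>c. rigid_category.left_dimension C b c = cnj (rigid_category.left_dimension C a c))"
proof -
  interpret fusion_category C by (rule assms(1))
  interpret pivotal_fusion_category C a
    by unfold_locales (rule assms(2))
  show ?thesis
    using pivotal_conjugate left_dimension_conjugate by blast
qed

end
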